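(* In the problem described in the context, with initial point $q_0=(0,0,0)$, the following holds (uniqueness is understood up to reparametrization). (1) Let $q_1\in\operatorname{int}\mathcal A_2$. Then there exists a unique optimal trajectory $\operatorname{Exp}(\lambda,t)$, $t\in[0,t_1]$, where $(\lambda,t_1)=\operatorname{Exp}^{-1}(q_1)$. (2) Let $q_1=(x_1,y_1,z_1)\in\partial\mathcal A_2$, $-y_1<x_1\le y_1$, $z_1=z^2(x_1,y_1)$. Then there exists a unique optimal trajectory, corresponding to the control $u(t)=(1,1)$ for $t\in[0,\tau_1]$, $u(t)=(1,-1)$ for $t\in[\tau_1,t_1]$: $$q(t)=\begin{cases}e^{t(X_1+X_2)}(q_0),& t\in[0,\tau_1],\\ e^{(t-\tau_1)(X_1-X_2)}\circ e^{\tau_1(X_1+X_2)}(q_0),& t\in[\tau_1,t_1],\end{cases}$$ with $\tau_1=(y_1+x_1)/2$, $t_1=x_1$. (3) Let $q_1=(x_1,y_1,z_1)\in\partial\mathcal A_2$, $-y_1\le x_1<y_1$, $z_1=z^1(x_1,y_1)$. Then there exists a unique optimal trajectory, corresponding to the control $u(t)=(1,-1)$ for $t\in[0,\tau_1]$, $u(t)=(1,1)$ for $t\in[\tau_1,t_1]$: $$q(t)=\begin{cases}e^{t(X_1-X_2)}(q_0),& t\in[0,\tau_1],\\ e^{(t-\tau_1)(X_1+X_2)}\circ e^{\tau_1(X_1-X_2)}(q_0),& t\in[\tau_1,t_1],\end{cases}$$ with $\tau_1=(y_1+x_1)/2$, $t_1=x_1$.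
   Context: Let $M=\mathbb R^3$ with coordinates $(x,y,z)$, $X_1=\frac{\partial}{\partial x}$, $X_2=\frac{\partial}{\partial y}+\frac{x^2}{2}\frac{\partial}{\partial z}$, $U_2=\{(u_1,u_2)\in\mathbb R^2: u_1\ge|u_2|\}$; $e^{tX}$ denotes the flow of a vector field $X$. An admissible trajectory is a Lipschitz curve $q:[0,t_1]\to M$ ($t_1\ge0$ free) with $\dot q=u_1X_1(q)+u_2X_2(q)$ a.e. for some control $u=(u_1,u_2)$ with values in $U_2$; its length is $l=\int_0^{t_1}\sqrt{u_1^2-u_2^2}\,dt$. It is optimal if its length is maximal among all admissible trajectories with the same endpoints. $\mathcal A_2$ is the set of endpoints of admissible trajectories starting at $q_0$. Put $z^1(x,y)=\frac{(x+y)^3-4x^3}{24}$ and $z^2(x,y)=\frac{4x^3-(x-y)^3}{24}$. Exponential mapping. For $\lambda=(\psi_0,c)\in C:=\mathbb R^2$ let $(\psi,x,y,z)(t)$ be the solution of $\dot\psi=cx$, $\dot c=0$, $\dot x=\cosh\psi$, $\dot y=\sinh\psi$, $\dot z=\frac{x^2}{2}\sinh\psi$ with $\psi(0)=\psi_0$, $x(0)=y(0)=z(0)=0$ (the arclength parametrized normal extremals of the Pontryagin maximum principle), and set $\operatorname{Exp}(\lambda,t)=(x(t),y(t),z(t))$. The mapping $\operatorname{Exp}$ is considered on $N=\{(\lambda,t): \lambda\in C,\ t\in(0,+\infty)\text{ for }c=0,\ t\in(0,K(k)/(l\,\text{æ}))\text{ for }c\ne0\}$, where $l=\sqrt{|c|}$,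 $E=\frac{cx^2}{2}-\sinh\psi=-\sinh\psi_0$ is a first integral, $\text{æ}=\sqrt{\sqrt{1+E^2}/2}$, $k=\sqrt{\frac12\big(1+\frac{E}{\sqrt{1+E^2}}\big)}$, and $K(k)=\int_0^{\pi/2}\frac{d\theta}{\sqrt{1-k^2\sin^2\theta}}$. $\operatorname{Exp}^{-1}$ denotes the inverse of $\operatorname{Exp}:N\to\operatorname{int}\mathcal A_2$.
   Formalization: For c<0 the modulus k is taken with −E in place of E (the printed bound on t is not the blow-up time); besides (2), (3) as printed, the corrected cases are covered: (2) −x₁<y₁≤x₁, z₁=z¹; (3) −x₁≤y₁<x₁, z₁=z², τ₁=(x₁−y₁)/2. *)

theory Defs
  imports "HOL-Analysis.Analysis"
begin

type_synonym point = "real \<times> real \<times> real"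

definition X1 :: "point \<Rightarrow> point" where
  "X1 q = (1, 0, 0)"

definition X2 :: "point \<Rightarrow> point" where
  "X2 = (\<lambda>(x, y, z). (0, 1, x\<^sup>2 / 2))"

definition q0 :: point where
  "q0 = (0, 0, 0)"

text \<open>The integral curve is only required to exist between times \<open>0\<close> and \<open>t\<close>,
  so that the flow also makes sense for incomplete vector fields.\<close>

definition flow :: "('a \<Rightarrow> 'a) \<Rightarrow> real \<Rightarrow> 'a \<Rightarrow> 'a::real_normed_vector" where
  "flow X t p = (THE q. \<exists>\<gamma>. \<gamma> 0 = p \<and> \<gamma> t = q \<and>
     (\<forall>s\<in>closed_segment 0 t.
        (\<gamma> has_vector_derivative X (\<gamma> s)) (at s within closed_segment 0 t)))"

definition U2 :: "(real \<times> real) set" where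
  "U2 = {(u1, u2). u1 \<ge> \<bar>u2\<bar>}"

text \<open>A trajectory is a pair of a terminal time \<open>t1\<close> and a map \<open>q\<close>, of which only the
  restriction to \<open>{0..t1}\<close> matters.\<close>

definition corresponds_to_control ::
  "real \<Rightarrow> (real \<Rightarrow> point) \<Rightarrow> (real \<Rightarrow> real \<times> real) \<Rightarrow> bool" where
  "corresponds_to_control t1 q u \<longleftrightarrow>
     u \<in> borel_measurable (lebesgue_on {0..t1}) \<and>
     (\<forall>t\<in>{0..t1}. u t \<in> U2) \<and>
     (AE t in lebesgue_on {0..t1}.
        (q has_vector_derivative
           fst (u t) *\<^sub>R X1 (q t) + snd (u t) *\<^sub>R X2 (q t)) (at t within {0..t1}))"

definition admissible :: "real \<Rightarrow> (real \<Rightarrow> point) \<Rightarrow> (real \<Rightarrow> real \<times> real) \<Rightarrow> bool" where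
  "admissible t1 q u \<longleftrightarrow>
     0 \<le> t1 \<and> (\<exists>L. L-lipschitz_on {0..t1} q) \<and> corresponds_to_control t1 q u"

text \<open>As \<open>X1\<close> and \<open>X2\<close> are pointwise linearly independent, a trajectory determines its
  control almost everywhere, hence also its length.\<close>

definition slength :: "real \<Rightarrow> (real \<Rightarrow> real \<times> real) \<Rightarrow> real" where
  "slength t1 u = (LINT t|lebesgue_on {0..t1}. sqrt ((fst (u t))\<^sup>2 - (snd (u t))\<^sup>2))"

definition optimal :: "real \<Rightarrow> (real \<Rightarrow> point) \<Rightarrow> bool" where
  "optimal t1 q \<longleftrightarrow> (\<exists>u. admissible t1 q u \<and>
     (\<forall>t1' q' u'. admissible t1' q' u' \<and> q' 0 = q 0 \<and> q' t1' = q t1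
        \<longrightarrow> slength t1' u' \<le> slength t1 u))"

definition A2 :: "point set" where
  "A2 = {q1. \<exists>t1 q u. admissible t1 q u \<and> q 0 = q0 \<and> q t1 = q1}"

text \<open>The change of parameter need not be strictly monotone: since \<open>(0, 0) \<in> U2\<close>, an
  admissible trajectory may stay at a point for a while.\<close>

definition reparametrization_of ::
  "real \<Rightarrow> (real \<Rightarrow> point) \<Rightarrow> real \<Rightarrow> (real \<Rightarrow> point) \<Rightarrow> bool" where
  "reparametrization_of t1 q t1' q' \<longleftrightarrow>
     (\<exists>\<phi>. continuous_on {0..t1'} \<phi> \<and> mono_on {0..t1'} \<phi> \<and> \<phi> ` {0..t1'} = {0..t1} \<and>
        (\<forall>t\<in>{0..t1'}. q' t = q (\<phi> t)))"

definition unique_optimal :: "point \<Rightarrow> real \<Rightarrow> (real \<Rightarrow> point) \<Rightarrow> bool" where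
  "unique_optimal q1 t1 q \<longleftrightarrow>
     optimal t1 q \<and> q 0 = q0 \<and> q t1 = q1 \<and>
     (\<forall>t1' q'. optimal t1' q' \<and> q' 0 = q0 \<and> q' t1' = q1
        \<longrightarrow> reparametrization_of t1 q t1' q')"

definition zb1 :: "real \<Rightarrow> real \<Rightarrow> real" where
  "zb1 x y = ((x + y)^3 - 4 * x^3) / 24"

definition zb2 :: "real \<Rightarrow> real \<Rightarrow> real" where
  "zb2 x y = (4 * x^3 - (x - y)^3) / 24"

text \<open>Normal extremals, with state \<open>(\<psi>, c, x, y, z)\<close>.\<close>

definition extremal_field ::
  "real \<times> real \<times> point \<Rightarrow> real \<times> real \<times> point" where
  "extremal_field =
     (\<lambda>(\<psi>, c, x, y, z). (c * x, 0, cosh \<psi>, sinh \<psi>, x\<^sup>2 / 2 * sinh \<psi>))"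

definition Exp :: "(real \<times> real) \<times> real \<Rightarrow> point" where
  "Exp = (\<lambda>((\<psi>0, c), t). snd (snd (flow extremal_field t (\<psi>0, c, q0))))"

definition elliptic_K :: "real \<Rightarrow> real" where
  "elliptic_K k = integral {0..pi/2} (\<lambda>\<theta>. 1 / sqrt (1 - k\<^sup>2 * (sin \<theta>)\<^sup>2))"

definition E0 :: "real \<Rightarrow> real" where
  "E0 \<psi>0 = - sinh \<psi>0"

definition ae :: "real \<Rightarrow> real" where
  "ae \<psi>0 = sqrt (sqrt (1 + (E0 \<psi>0)\<^sup>2) / 2)"

text \<open>The factor \<open>sgn c\<close> is \<open>1\<close> for \<open>c > 0\<close>.  For \<open>c < 0\<close> it accounts for the reflection
  \<open>(\<psi>, c, x, y, z) \<mapsto> (-\<psi>, -c, x, -y, -z)\<close>, which preserves the extremals and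
  changes the sign of the first integral \<open>c x\<^sup>2 / 2 - sinh \<psi>\<close>.  With it,
  \<open>elliptic_K (modulus \<psi>0 c) / (sqrt \<bar>c\<bar> * ae \<psi>0)\<close> is the blow-up time of the extremal
  for either sign of \<open>c\<close>; without it, extremals with \<open>c < 0\<close> would be truncated
  or continued past their blow-up.\<close>

definition modulus :: "real \<Rightarrow> real \<Rightarrow> real" where
  "modulus \<psi>0 c = sqrt ((1 + sgn c * E0 \<psi>0 / sqrt (1 + (E0 \<psi>0)\<^sup>2)) / 2)"

definition N :: "((real \<times> real) \<times> real) set" where
  "N = {((\<psi>0, c), t). 0 < t \<and>
     (c \<noteq> 0 \<longrightarrow> t < elliptic_K (modulus \<psi>0 c) / (sqrt \<bar>c\<bar> * ae \<psi>0))}"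

definition Exp_inv :: "point \<Rightarrow> (real \<times> real) \<times> real" where
  "Exp_inv = the_inv_into N Exp"

definition switched_control ::
  "real \<times> real \<Rightarrow> real \<times> real \<Rightarrow> real \<Rightarrow> real \<Rightarrow> real \<times> real" where
  "switched_control v w \<tau> t = (if t \<le> \<tau> then v else w)"

definition switched_curve ::
  "(point \<Rightarrow> point) \<Rightarrow> (point \<Rightarrow> point) \<Rightarrow> real \<Rightarrow> real \<Rightarrow> point" where
  "switched_curve X Y \<tau> t =
     (if t \<le> \<tau> then flow X t q0 else flow Y (t - \<tau>) (flow X \<tau> q0))"

abbreviation X_plus :: "point \<Rightarrow> point" where
  "X_plus \<equiv> (\<lambda>q. X1 q + X2 q)"

abbreviation X_minus :: "point \<Rightarrow> point" where
  "X_minus \<equiv> (\<lambda>q. X1 q - X2 q)"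

definition plus_minus :: "point \<Rightarrow> real \<Rightarrow> real \<Rightarrow> bool" where
  "plus_minus q1 \<tau>1 t1 \<longleftrightarrow> 0 \<le> \<tau>1 \<and> \<tau>1 \<le> t1 \<and>
     unique_optimal q1 t1 (switched_curve X_plus X_minus \<tau>1) \<and>
     corresponds_to_control t1 (switched_curve X_plus X_minus \<tau>1)
       (switched_control (1, 1) (1, -1) \<tau>1)"

definition minus_plus :: "point \<Rightarrow> real \<Rightarrow> real \<Rightarrow> bool" where
  "minus_plus q1 \<tau>1 t1 \<longleftrightarrow> 0 \<le> \<tau>1 \<and> \<tau>1 \<le> t1 \<and>
     unique_optimal q1 t1 (switched_curve X_minus X_plus \<tau>1) \<and>
     corresponds_to_control t1 (switched_curve X_minus X_plus \<tau>1)
       (switched_control (1, -1) (1, 1) \<tau>1)"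

end

theory Submission
  imports Defs
begin

text \<open>
  Along an admissible trajectory \<open>x\<close> is nondecreasing, and up to reparametrization the
  trajectory is a graph over \<open>x\<close>: with the slope \<open>v = y'\<close>, \<open>\<bar>v\<bar> \<le> 1\<close>, and the terminal value
  \<open>X\<close> of \<open>x\<close>, the problem is to maximize the concave functional \<open>\<integral> sqrt (1 - v\<^sup>2) ds\<close> over
  \<open>[0, X]\<close> when \<open>\<integral> v ds = y1\<close> and \<open>\<integral> s\<^sup>2 / 2 v ds = z1\<close> are prescribed. So the Lagrange
  multiplier conditions are sufficient for optimality. In terms of the trajectory itself,
  let \<open>p s = a + c s\<^sup>2 / 2\<close> and \<open>h s = sqrt (\<epsilon>\<^sup>2 + (p s)\<^sup>2)\<close>. The Cauchy--Schwarz inequality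
  gives \<open>\<epsilon> sqrt (u1\<^sup>2 - u2\<^sup>2) + p u2 \<le> h u1\<close>, and integration gives
  \<open>\<epsilon> length + a y1 + c z1 \<le> \<integral> h ds\<close> (\<open>length_le\<close>). In the case of equality the control
  satisfies \<open>u2 = (p / h) u1\<close> almost everywhere (\<open>length_eq_imp_feedback\<close>), and this
  feedback determines \<open>y\<close> and \<open>z\<close> as functions of \<open>x\<close> (\<open>graph_of_feedback\<close>), that is, the
  trajectory up to reparametrization.

  For \<open>\<epsilon> = 1\<close> the equality case consists of the normal extremals, with \<open>sinh \<psi> = p\<close>. For
  \<open>\<epsilon> = 0\<close> and \<open>p\<close> with a zero at \<open>\<tau> \<ge> 0\<close> it consists of the bang-bang curves that switch
  when \<open>x = \<tau>\<close>. These have length \<open>0\<close>, but up to reparametrization they are the only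
  trajectories to their endpoints, and the inequality itself says that the attainable set
  lies between the surfaces \<open>zb1\<close> and \<open>zb2\<close> that they sweep out (\<open>A2_subset_hull\<close>).

  It remains to see that \<open>Exp\<close> maps \<open>N\<close> bijectively to the open region between these
  surfaces. A normal extremal reaches \<open>x = X\<close> at the time \<open>\<integral> 1 / h ds\<close> over \<open>[0, X]\<close>; the
  substitution \<open>s = s0 tan (\<theta> / 2)\<close> turns it into an elliptic integral and shows that its
  supremum is the bound in the definition of \<open>N\<close> (\<open>N_iff\<close>). With \<open>X\<close> fixed, the endpoint
  \<open>(y, z)\<close> is the gradient at \<open>(a, c)\<close> of the strictly convex function \<open>F (a, c) = \<integral> h ds\<close>.
  Strict convexity makes the endpoint map injective (\<open>normal_endpoint_inj\<close>). For
  surjectivity, a point \<open>(X, y, z)\<close> of the open region makes \<open>F (a, c) - a y - c z\<close>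
  coercive, because of the inequality for \<open>\<epsilon> = 0\<close>, and at a minimizer the gradient of \<open>F\<close> is
  \<open>(y, z)\<close> (\<open>dual_attains_min\<close>, \<open>normal_endpoint_surj\<close>).
\<close>

section \<open>Primitives of continuous functions\<close>

text \<open>The second integral makes \<open>primitive f\<close> a two-sided primitive near \<open>0\<close> and at negative
  arguments, so that no one-sided derivatives are needed at the left end of \<open>{0..X}\<close>.\<close>
definition primitive :: "(real \<Rightarrow> real) \<Rightarrow> real \<Rightarrow> real" where
  "primitive f x = integral {0..x} f - integral {x..0} f"

lemma primitive_0 [simp]: "primitive f 0 = 0"
  by (simp add: primitive_def)

lemma DERIV_primitive:
  assumes "continuous_on UNIV f"
  shows "(primitive f has_real_derivative f x) (at x)"
proof -
  define c where "c = min x 0 - 1"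
  define d where "d = max x 0 + 1"
  have int: "f integrable_on {u..v}" for u v
    using assms by (intro integrable_continuous_real continuous_on_subset[OF assms]) auto
  have eq: "primitive f y = integral {c..y} f - integral {c..0} f" if "y \<in> {c<..<d}" for y
  proof (cases "0 \<le> y")
    case True
    then have "integral {c..0} f + integral {0..y} f = integral {c..y} f"
      by (intro Henstock_Kurzweil_Integration.integral_combine int) (auto simp: c_def)
    then show ?thesis using True by (cases "y = 0") (auto simp: primitive_def)
  next
    case False
    then have "integral {c..y} f + integral {y..0} f = integral {c..0} f"
      using that by (intro Henstock_Kurzweil_Integration.integral_combine int) auto
    then show ?thesis using False by (auto simp: primitive_def)
  qed
  have "((\<lambda>y. integral {c..y} f) has_real_derivative f x) (at x within {c..d})"
    by (rule integral_has_real_derivative)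
      (auto simp: c_def d_def intro: continuous_on_subset[OF assms])
  then have "((\<lambda>y. integral {c..y} f) has_real_derivative f x) (at x)"
    by (subst (asm) at_within_Icc_at) (auto simp: c_def d_def)
  then have "((\<lambda>y. integral {c..y} f - integral {c..0} f) has_real_derivative f x) (at x)"
    by (auto intro!: derivative_eq_intros)
  then show ?thesis
    by (rule has_field_derivative_transform_within_open[where S = "{c<..<d}"])
      (auto simp: eq c_def d_def)
qed

lemma primitive_eqI:
  assumes "\<And>s. (H has_real_derivative h s) (at s)" "continuous_on UNIV h" "H 0 = 0"
  shows "primitive h s = H s"
proof -
  have "((\<lambda>s. primitive h s - H s) has_real_derivative 0) (at r)" for r
    using DERIV_primitive[OF assms(2)] assms(1) by (auto intro!: derivative_eq_intros)
  then have "primitive h s - H s = primitive h 0 - H 0"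
    by (intro DERIV_isconst_all) blast
  then show ?thesis using assms(3) by simp
qed

lemma primitive_le:
  assumes "continuous_on UNIV f" "continuous_on UNIV g" "0 \<le> X" "\<And>s. s \<in> {0..X} \<Longrightarrow> f s \<le> g s"
  shows "primitive f X \<le> primitive g X"
proof -
  have "primitive g 0 - primitive f 0 \<le> primitive g X - primitive f X"
  proof (rule DERIV_nonneg_imp_nondecreasing[OF assms(3)])
    fix s assume "0 \<le> s" "s \<le> X"
    then show "\<exists>D. ((\<lambda>s. primitive g s - primitive f s) has_real_derivative D) (at s) \<and> 0 \<le> D"
      using assms(4)[of s]
      by (intro exI[of _ "g s - f s"]) (auto intro!: DERIV_diff DERIV_primitive assms)
  qed
  then show ?thesis by simp
qed

lemma primitive_strict_mono:
  assumes "continuous_on UNIV f" "\<And>s. 0 < f s"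
  shows "r < s \<Longrightarrow> primitive f r < primitive f s"
  by (erule DERIV_pos_imp_increasing) (use assms DERIV_primitive in blast)

lemma primitive_eq_integral: "0 \<le> X \<Longrightarrow> primitive f X = integral {0..X} f"
  by (cases "X = 0") (auto simp: primitive_def)

lemma lipschitz_on_Icc_if_DERIV:
  fixes f :: "real \<Rightarrow> real"
  assumes der: "\<And>s. s \<in> {a..b} \<Longrightarrow> (f has_real_derivative f' s) (at s within {a..b})"
    and cont: "continuous_on {a..b} f'"
  obtains K where "K-lipschitz_on {a..b} f"
proof -
  have "compact (f' ` {a..b})"
    by (intro compact_continuous_image continuous_on_subset[OF cont]) auto
  then obtain B where B: "\<And>s. s \<in> {a..b} \<Longrightarrow> \<bar>f' s\<bar> \<le> B"
    using compact_imp_bounded bounded_iff by (metis image_eqI real_norm_def)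
  have "(max 0 B)-lipschitz_on {a..b} f"
  proof (rule bounded_derivative_imp_lipschitz)
    show "(f has_derivative (*) (f' s)) (at s within {a..b})" if "s \<in> {a..b}" for s
      using der[OF that] by (simp add: has_field_derivative_def)
    show "onorm ((*) (f' s)) \<le> max 0 B" if "s \<in> {a..b}" for s
      by (rule onorm_le) (use B[OF that] in \<open>auto simp: abs_mult intro!: mult_right_mono\<close>)
  qed auto
  then show ?thesis using that by blast
qed

lemma lipschitz_on_primitive:
  assumes "continuous_on UNIV f"
  obtains K where "K-lipschitz_on {a..b} (primitive f)"
  by (rule lipschitz_on_Icc_if_DERIV[of a b "primitive f" f])
    (auto intro: has_field_derivative_at_within DERIV_primitive assms continuous_on_subset[OF
        assms])

section \<open>The fundamental theorem of calculus for Lipschitz functions\<close>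

lemma DERIV_difference_quotient_seq:
  fixes f :: "real \<Rightarrow> real"
  assumes "(f has_real_derivative D) (at x)"
  shows "(\<lambda>n. (f (x + inverse (real (Suc n))) - f x) / inverse (real (Suc n))) \<longlonglongrightarrow> D"
proof -
  have "filterlim (\<lambda>n. inverse (real (Suc n))) (at 0) sequentially"
    using LIMSEQ_inverse_real_of_nat by (auto simp: filterlim_at)
  from filterlim_compose[OF assms[unfolded DERIV_def] this] show ?thesis .
qed

text \<open>The difference quotients of a Lipschitz function are bounded by the Lipschitz
  constant, so dominated convergence moves the limit out of the integral. The integral of a
  difference quotient over \<open>{a..b}\<close> is a difference of two averages of \<open>f\<close> over short
  intervals at \<open>a\<close> and at \<open>b\<close>.\<close>
lemma lipschitz_on_imp_integral_derivative:
  fixes f f' :: "real \<Rightarrow> real"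
  assumes ab: "a \<le> b" and lip: "L-lipschitz_on {a..b} f"
    and meas: "f' \<in> borel_measurable (lebesgue_on {a..b})"
    and der: "AE t in lebesgue_on {a..b}. (f has_real_derivative f' t) (at t within {a..b})"
  shows "integrable (lebesgue_on {a..b}) f'"
    and "integral\<^sup>L (lebesgue_on {a..b}) f' = f b - f a"
proof -
  let ?M = "lebesgue_on {a..b}"
  \<comment> \<open>\<open>f\<close> is continued by constants so that the quotients make sense up to the end \<open>b\<close>.\<close>
  define F where "F t = f (max a (min b t))" for t
  define h where "h n = inverse (real (Suc n))" for n
  define D where "D n t = (F (t + h n) - F t) / h n" for n t
  have h: "0 < h n" for n by (simp add: h_def)
  have L: "0 \<le> L" using lip by (rule lipschitz_on_nonneg)
  have F_lip: "\<bar>F s - F t\<bar> \<le> L * \<bar>s - t\<bar>" for s t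
  proof -
    have "\<bar>F s - F t\<bar> \<le> L * \<bar>max a (min b s) - max a (min b t)\<bar>"
      using lipschitz_onD[OF lip, of "max a (min b s)" "max a (min b t)"] ab
      by (auto simp: F_def dist_real_def)
    also have "\<dots> \<le> L * \<bar>s - t\<bar>"
      using L by (intro mult_left_mono) auto
    finally show ?thesis .
  qed
  have F_cont: "continuous_on UNIV F"
    by (rule lipschitz_on_continuous_on[of L])
      (auto intro!: lipschitz_onI simp: dist_real_def F_lip L)
  have D_cont: "continuous_on S (D n)" for n S
    unfolding D_def using h[of n]
    by (intro continuous_intros continuous_on_compose2[OF F_cont]) auto
  have D_bound: "\<bar>D n t\<bar> \<le> L" for n t
    using F_lip[of "t + h n" t] h[of n] by (simp add: D_def field_simps)
  have D_lim: "AE t in ?M. (\<lambda>n. D n t) \<longlonglongrightarrow> f' t"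
  proof -
    have "AE t in lebesgue. t \<notin> {a, b}"
      by (rule AE_not_in) (simp add: negligible_iff_null_sets[symmetric])
    then have "AE t in ?M. t \<noteq> a \<and> t \<noteq> b"
      by (subst AE_restrict_space_iff) auto
    with der AE_space show ?thesis
    proof eventually_elim
      case (elim t)
      then have t: "a < t" "t < b" by auto
      then have "(f has_real_derivative f' t) (at t)"
        using elim by (metis at_within_Icc_at)
      then have "(F has_real_derivative f' t) (at t)"
        by (rule has_field_derivative_transform_within_open[where S = "{a<..<b}"])
          (use t in \<open>auto simp: F_def\<close>)
      from DERIV_difference_quotient_seq[OF this] show ?case
        by (simp add: D_def h_def)
    qed
  qed
  interpret finite_measure ?M by (rule finite_measure_lebesgue_on) simp
  have D_meas: "D n \<in> borel_measurable ?M" for n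
    by (intro continuous_imp_measurable_on_sets_lebesgue D_cont) auto
  have int_L: "integrable ?M (\<lambda>t. L)" by simp
  show "integrable ?M f'"
    by (rule integrable_dominated_convergence[OF meas D_meas int_L D_lim]) (simp add: D_bound)
  have lim1: "(\<lambda>n. integral\<^sup>L ?M (D n)) \<longlonglongrightarrow> integral\<^sup>L ?M f'"
    by (rule integral_dominated_convergence[OF meas D_meas int_L D_lim]) (simp add: D_bound)
  define P where "P = primitive F"
  have P: "(P has_real_derivative F t) (at t)" for t
    unfolding P_def by (rule DERIV_primitive[OF F_cont])
  have "integral\<^sup>L ?M (D n) = (P (b + h n) - P b) / h n - (P (a + h n) - P a) / h n" for n
  proof -
    define Q where "Q t = (P (t + h n) - P t) / h n" for t
    have "((\<lambda>t. P (t + h n)) has_real_derivative F (t + h n)) (at t)" for t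
      using P by (metis DERIV_shift)
    then have "(Q has_real_derivative D n t) (at t)" for t
      unfolding Q_def D_def using h[of n] by (auto intro!: derivative_eq_intros P)
    then have "(D n has_integral Q b - Q a) {a..b}"
      by (intro fundamental_theorem_of_calculus ab)
        (auto simp: has_real_derivative_iff_has_vector_derivative
          intro: has_vector_derivative_at_within)
    moreover have "integrable ?M (D n)"
      by (rule integrable_const_bound[of _ L]) (auto simp: D_bound D_meas)
    ultimately show ?thesis
      by (simp add: lebesgue_integral_eq_integral integral_unique Q_def diff_divide_distrib)
  qed
  then have lim2: "(\<lambda>n. integral\<^sup>L ?M (D n)) \<longlonglongrightarrow> F b - F a"
    unfolding h_def by (simp only:) (intro tendsto_diff DERIV_difference_quotient_seq P)
  show "integral\<^sup>L ?M f' = f b - f a"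
    using LIMSEQ_unique[OF lim1 lim2] ab by (simp add: F_def)
qed

lemma lipschitz_on_AE_derivative_nonneg_imp_le:
  fixes f :: "real \<Rightarrow> real"
  assumes ab: "a \<le> b" and lip: "L-lipschitz_on {a..b} f"
    and meas: "f' \<in> borel_measurable (lebesgue_on {a..b})"
    and der: "AE t in lebesgue_on {a..b}. (f has_real_derivative f' t) (at t within {a..b})"
    and nonneg: "AE t in lebesgue_on {a..b}. 0 \<le> f' t"
  shows "f a \<le> f b"
  using lipschitz_on_imp_integral_derivative(2)[OF assms(1-4)] integral_nonneg_AE[OF nonneg] by simp

section \<open>Trajectories issuing from the origin\<close>

lemma AE_lebesgue_on_subset:
  assumes "AE t in lebesgue_on T. P t" "S \<subseteq> T" "S \<in> sets lebesgue" "T \<in> sets lebesgue"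
  shows "AE t in lebesgue_on S. P t"
  using assms by (auto simp: AE_restrict_space_iff)

lemma AE_lebesgue_on_notin_countable:
  assumes "S \<in> sets lebesgue" "countable (A :: real set)"
  shows "AE t in lebesgue_on S. t \<notin> A"
proof -
  have "AE t in lebesgue. t \<notin> A"
    using countable_imp_null_set_lborel[OF assms(2)] by (intro AE_not_in null_sets_completionI)
  then show ?thesis
    using assms by (subst AE_restrict_space_iff) auto
qed

text \<open>This is the part of the chain rule that survives at points where the outer function is
  only Lipschitz.\<close>
lemma has_real_derivative_zero_lipschitz_compose:
  fixes f g :: "real \<Rightarrow> real"
  assumes lip: "K-lipschitz_on T g" and sub: "f ` S \<subseteq> T" and t: "t \<in> S"
    and der: "(f has_real_derivative 0) (at t within S)"
  shows "((\<lambda>s. g (f s)) has_real_derivative 0) (at t within S)"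
  unfolding has_field_derivative_iff
proof (rule Lim_null_comparison)
  have "((\<lambda>s. (f s - f t) / (s - t)) \<longlongrightarrow> 0) (at t within S)"
    using der by (simp add: has_field_derivative_iff)
  from tendsto_mult[OF tendsto_const[of K] tendsto_rabs[OF this]]
  show "((\<lambda>s. K * \<bar>(f s - f t) / (s - t)\<bar>) \<longlongrightarrow> 0) (at t within S)" by simp
  show "\<forall>\<^sub>F s in at t within S. norm ((g (f s) - g (f t)) / (s - t)) \<le> K * \<bar>(f s - f t) / (s - t)\<bar>"
    unfolding eventually_at_filter
  proof (rule always_eventually, intro allI impI)
    fix s assume "s \<noteq> t" "s \<in> S"
    then have "\<bar>g (f s) - g (f t)\<bar> / \<bar>s - t\<bar> \<le> K * \<bar>f s - f t\<bar> / \<bar>s - t\<bar>"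
      using lipschitz_onD[OF lip, of "f s" "f t"] sub t
      by (intro divide_right_mono) (auto simp: dist_real_def image_subset_iff)
    then show "norm ((g (f s) - g (f t)) / (s - t)) \<le> K * \<bar>(f s - f t) / (s - t)\<bar>"
      by (simp add: abs_divide)
  qed
qed

locale trajectory =
  fixes t1 :: real and q :: "real \<Rightarrow> point" and u :: "real \<Rightarrow> real \<times> real"
  assumes adm: "admissible t1 q u" and start: "q 0 = q0"
begin

definition "x t = fst (q t)"
definition "y t = fst (snd (q t))"
definition "z t = snd (snd (q t))"
definition "u1 t = fst (u t)"
definition "u2 t = snd (u t)"

lemma q_eq: "q t = (x t, y t, z t)"
  by (simp add: x_def y_def z_def)

lemma t1_nonneg: "0 \<le> t1"
  using adm by (simp add: admissible_def)

lemma initial [simp]: "x 0 = 0" "y 0 = 0" "z 0 = 0"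
  using start by (simp_all add: x_def y_def z_def q0_def)

lemma u_measurable [measurable]:
  "u1 \<in> borel_measurable (lebesgue_on {0..t1})" "u2 \<in> borel_measurable (lebesgue_on {0..t1})"
proof -
  have u: "u \<in> borel_measurable (lebesgue_on {0..t1})"
    using adm by (simp add: admissible_def corresponds_to_control_def)
  show "u1 \<in> borel_measurable (lebesgue_on {0..t1})" "u2 \<in> borel_measurable (lebesgue_on {0..t1})"
    unfolding u1_def u2_def
    by (rule measurable_compose[OF u], simp add: borel_prod[symmetric])+
qed

lemma abs_u2_le: "t \<in> {0..t1} \<Longrightarrow> \<bar>u2 t\<bar> \<le> u1 t"
  using adm by (force simp: admissible_def corresponds_to_control_def U2_def u1_def u2_def)

lemma AE_control:
  "AE t in lebesgue_on {0..t1}. t \<in> {0..t1} \<and> \<bar>u2 t\<bar> \<le> u1 t \<and>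
     (x has_real_derivative u1 t) (at t within {0..t1}) \<and>
     (y has_real_derivative u2 t) (at t within {0..t1}) \<and>
     (z has_real_derivative (x t)\<^sup>2 / 2 * u2 t) (at t within {0..t1})"
proof -
  have "AE t in lebesgue_on {0..t1}. (q has_vector_derivative
           fst (u t) *\<^sub>R X1 (q t) + snd (u t) *\<^sub>R X2 (q t)) (at t within {0..t1})"
    using adm by (simp add: admissible_def corresponds_to_control_def)
  with AE_space show ?thesis
  proof eventually_elim
    case (elim t)
    then have t: "t \<in> {0..t1}" by simp
    note fst = bounded_linear.has_vector_derivative[OF bounded_linear_fst]
    note snd = bounded_linear.has_vector_derivative[OF bounded_linear_snd]
    show ?case
      using t abs_u2_le[OF t] fst[OF elim(2)] fst[OF snd[OF elim(2)]] snd[OF snd[OF elim(2)]]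
      by (simp add: has_real_derivative_iff_has_vector_derivative X1_def X2_def x_def[abs_def]
          y_def[abs_def] z_def[abs_def] u1_def u2_def case_prod_beta mult.commute)
  qed
qed

lemma lipschitz:
  obtains L where "L-lipschitz_on {0..t1} x" "L-lipschitz_on {0..t1} y" "L-lipschitz_on {0..t1} z"
proof -
  obtain L where L: "L-lipschitz_on {0..t1} q"
    using adm by (auto simp: admissible_def)
  have *: "dist (fst a) (fst b) \<le> dist a b" "dist (fst (snd a)) (fst (snd b)) \<le> dist a b"
      "dist (snd (snd a)) (snd (snd b)) \<le> dist a b" for a b :: point
    by (meson dist_fst_le dist_snd_le order_trans)+
  have "L-lipschitz_on {0..t1} x" "L-lipschitz_on {0..t1} y" "L-lipschitz_on {0..t1} z"
    using L * unfolding lipschitz_on_def x_def y_def z_def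
    by (blast intro: order_trans)+
  then show ?thesis using that by blast
qed

lemma x_continuous: "continuous_on {0..t1} x"
  using lipschitz lipschitz_on_continuous_on by metis

lemma restrict:
  assumes "T \<in> {0..t1}"
  shows "trajectory T q u"
proof unfold_locales
  have sub: "{0..T} \<subseteq> {0..t1}" using assms by auto
  obtain L where L: "L-lipschitz_on {0..t1} q"
    using adm by (auto simp: admissible_def)
  have "u \<in> borel_measurable (lebesgue_on {0..T})"
    using adm by (intro measurable_restrict_mono[OF _ sub])
      (simp add: admissible_def corresponds_to_control_def)
  moreover have "AE t in lebesgue_on {0..T}. (q has_vector_derivative
           fst (u t) *\<^sub>R X1 (q t) + snd (u t) *\<^sub>R X2 (q t)) (at t within {0..T})"
  proof -
    have "AE t in lebesgue_on {0..t1}. (q has_vector_derivative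
           fst (u t) *\<^sub>R X1 (q t) + snd (u t) *\<^sub>R X2 (q t)) (at t within {0..t1})"
      using adm by (simp add: admissible_def corresponds_to_control_def)
    from AE_lebesgue_on_subset[OF this sub] show ?thesis
      by (auto elim!: eventually_mono intro: has_vector_derivative_within_subset[OF _ sub])
  qed
  ultimately show "admissible T q u"
    using adm assms sub lipschitz_on_subset[OF L sub]
    by (auto simp: admissible_def corresponds_to_control_def)
  show "q 0 = q0" by (rule start)
qed

lemma x_mono:
  assumes "0 \<le> s" "s \<le> t" "t \<le> t1"
  shows "x s \<le> x t"
proof -
  obtain L where L: "L-lipschitz_on {0..t1} x" by (rule lipschitz)
  have sub: "{s..t} \<subseteq> {0..t1}" using assms by auto
  have "AE r in lebesgue_on {s..t}.
      (x has_real_derivative u1 r) (at r within {s..t}) \<and> 0 \<le> u1 r"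
  proof -
    have "AE r in lebesgue_on {0..t1}. (x has_real_derivative u1 r) (at r within {s..t}) \<and> 0 \<le> u1 r"
      using AE_control
      by eventually_elim (auto intro: has_field_derivative_subset[OF _ sub])
    from AE_lebesgue_on_subset[OF this sub] show ?thesis by simp
  qed
  then have AE: "AE r in lebesgue_on {s..t}. (x has_real_derivative u1 r) (at r within {s..t})"
      "AE r in lebesgue_on {s..t}. 0 \<le> u1 r"
    by auto
  show ?thesis
    by (rule lipschitz_on_AE_derivative_nonneg_imp_le[where f = x and f' = u1])
      (use AE assms lipschitz_on_subset[OF L sub] measurable_restrict_mono[OF u_measurable(1) sub]
        in auto)
qed

lemma x_range: "t \<in> {0..t1} \<Longrightarrow> x t \<in> {0..x t1}"
  using x_mono[of 0 t] x_mono[of t t1] by auto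

text \<open>As \<open>x\<close> is monotone, a level set is an interval on which \<open>x\<close> is constant; a point of it
  where the derivative is nonzero can only be its last point. So a switching surface \<open>x = \<tau>\<close>
  is met either at a single moment or while the trajectory stands still.\<close>
lemma AE_level_stationary: "AE t in lebesgue_on {0..t1}. x t = \<tau> \<longrightarrow> u1 t = 0 \<and> u2 t = 0"
proof -
  define B where "B = {t \<in> {0..t1}. x t = \<tau> \<and>
    (x has_real_derivative u1 t) (at t within {0..t1}) \<and> u1 t \<noteq> 0}"
  have False if st: "s \<in> B" "t \<in> B" "s < t" for s t
  proof -
    have sub: "{s..t} \<subseteq> {0..t1}" and xst: "x s = \<tau>" "x t = \<tau>" using st by (auto simp: B_def)
    have "x r = \<tau>" if "r \<in> {s..t}" for r
      using x_mono[of s r] x_mono[of r t] that sub xst st(3) by fastforce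
    then have "(x has_real_derivative 0) (at s within {s..t})"
      using st(3)
      by (intro has_field_derivative_transform_within[where g = x,
            OF DERIV_const[of \<tau>] zero_less_one]) auto
    moreover have "(x has_real_derivative u1 s) (at s within {s..t})"
      using st(1) sub by (auto simp: B_def intro: has_field_derivative_subset)
    ultimately have "u1 s = 0"
      using st(3) vector_derivative_unique_within_closed_interval[of s t s x 0 "u1 s"]
      by (simp add: has_real_derivative_iff_has_vector_derivative)
    then show False using st(1) by (simp add: B_def)
  qed
  then have "s = t" if "s \<in> B" "t \<in> B" for s t
    using that by (meson linorder_neqE_linordered_idom)
  then have "\<exists>t0. B \<subseteq> {t0}" by blast
  then have "countable B"
    using countable_subset uncountable_infinite by auto
  then have "AE t in lebesgue_on {0..t1}. t \<notin> B"
    by (intro AE_lebesgue_on_notin_countable) auto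
  with AE_control show ?thesis
    by eventually_elim (auto simp: B_def)
qed

text \<open>At the exceptional value \<open>\<tau>\<close>, where \<open>H\<close> may have a corner, the trajectory is
  stationary almost everywhere, and both sides vanish.\<close>
lemma AE_chain:
  assumes lip: "K-lipschitz_on {0..x t1} H"
    and der: "\<And>s. s \<noteq> \<tau> \<Longrightarrow> (H has_real_derivative h s) (at s)"
  shows "AE t in lebesgue_on {0..t1}.
    ((\<lambda>t. H (x t)) has_real_derivative h (x t) * u1 t) (at t within {0..t1})"
  using AE_control AE_level_stationary[of \<tau>]
proof eventually_elim
  case (elim t)
  show ?case
  proof (cases "x t = \<tau>")
    case True
    then show ?thesis
      using elim has_real_derivative_zero_lipschitz_compose[OF lip, of x "{0..t1}" t]
      by (metis image_subsetI mult_zero_right x_range)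
  next
    case False
    then show ?thesis
      using elim DERIV_chain2[where f = H and g = x, OF der[OF False]] by auto
  qed
qed

lemma lipschitz_compose_x:
  assumes "K-lipschitz_on {0..x t1} H"
  obtains K' where "K'-lipschitz_on {0..t1} (\<lambda>t. H (x t))"
proof -
  obtain L where L: "L-lipschitz_on {0..t1} x" by (rule lipschitz)
  have "K-lipschitz_on (x ` {0..t1}) H"
    using x_range by (intro lipschitz_on_subset[OF assms]) auto
  from lipschitz_on_compose2[OF L this] that show ?thesis by blast
qed

text \<open>Under the feedback \<open>u2 = V (x) u1\<close> the functions \<open>y - Y (x)\<close> and \<open>z - Z (x)\<close> are
  Lipschitz with derivative \<open>0\<close> almost everywhere, hence constant. The value \<open>\<tau>\<close> is where
  the feedback of a bang-bang extremal switches.\<close>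
lemma graph_of_feedback_endpoint:
  assumes fb: "AE t in lebesgue_on {0..t1}. x t \<noteq> \<tau> \<longrightarrow> u2 t = V (x t) * u1 t"
    and lipY: "K-lipschitz_on {0..x t1} Y" and lipZ: "K'-lipschitz_on {0..x t1} Z"
    and derY: "\<And>s. s \<noteq> \<tau> \<Longrightarrow> (Y has_real_derivative V s) (at s)"
    and derZ: "\<And>s. s \<noteq> \<tau> \<Longrightarrow> (Z has_real_derivative s\<^sup>2 / 2 * V s) (at s)"
    and zero: "Y 0 = 0" "Z 0 = 0"
  shows "q t1 = (x t1, Y (x t1), Z (x t1))"
proof -
  obtain L where L: "L-lipschitz_on {0..t1} y" "L-lipschitz_on {0..t1} z"
    using lipschitz by metis
  obtain M1 where M1: "M1-lipschitz_on {0..t1} (\<lambda>t. Y (x t))"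
    by (rule lipschitz_compose_x[OF lipY])
  obtain M2 where M2: "M2-lipschitz_on {0..t1} (\<lambda>t. Z (x t))"
    by (rule lipschitz_compose_x[OF lipZ])
  note chain = AE_chain[where \<tau> = \<tau>, OF lipY derY] AE_chain[where \<tau> = \<tau>, OF lipZ derZ]
  have "AE t in lebesgue_on {0..t1}.
    ((\<lambda>t. y t - Y (x t)) has_real_derivative 0) (at t within {0..t1}) \<and>
    ((\<lambda>t. z t - Z (x t)) has_real_derivative 0) (at t within {0..t1})"
    using AE_control fb AE_level_stationary[of \<tau>] chain[simplified]
  proof eventually_elim
    case (elim t)
    have "u2 t = V (x t) * u1 t" using elim by auto
    then show ?case
      using elim by (auto intro!: derivative_eq_intros)
  qed
  then have AE: "AE t in lebesgue_on {0..t1}.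
    ((\<lambda>t. y t - Y (x t)) has_real_derivative 0) (at t within {0..t1})"
    "AE t in lebesgue_on {0..t1}.
    ((\<lambda>t. z t - Z (x t)) has_real_derivative 0) (at t within {0..t1})"
    by auto
  have "y t1 - Y (x t1) = y 0 - Y (x 0)"
    using lipschitz_on_imp_integral_derivative(2)[OF t1_nonneg lipschitz_on_diff[OF L(1) M1] _
        AE(1)]
    by simp
  moreover have "z t1 - Z (x t1) = z 0 - Z (x 0)"
    using lipschitz_on_imp_integral_derivative(2)[OF t1_nonneg lipschitz_on_diff[OF L(2) M2] _
        AE(2)]
    by simp
  ultimately show ?thesis by (simp add: q_eq zero)
qed

lemma graph_of_feedback:
  assumes fb: "AE t in lebesgue_on {0..t1}. x t \<noteq> \<tau> \<longrightarrow> u2 t = V (x t) * u1 t"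
    and lipY: "K-lipschitz_on {0..x t1} Y" and lipZ: "K'-lipschitz_on {0..x t1} Z"
    and der: "\<And>s. s \<noteq> \<tau> \<Longrightarrow> (Y has_real_derivative V s) (at s)"
      "\<And>s. s \<noteq> \<tau> \<Longrightarrow> (Z has_real_derivative s\<^sup>2 / 2 * V s) (at s)"
      "Y 0 = 0" "Z 0 = 0"
    and T: "T \<in> {0..t1}"
  shows "q T = (x T, Y (x T), Z (x T))"
proof -
  interpret T: trajectory T q u by (rule restrict[OF T])
  have sub: "{0..T} \<subseteq> {0..t1}" "{0..x T} \<subseteq> {0..x t1}"
    using T x_range[OF T] by auto
  show ?thesis
    using T.graph_of_feedback_endpoint[OF AE_lebesgue_on_subset[OF fb sub(1)]
        lipschitz_on_subset[OF lipY sub(2)] lipschitz_on_subset[OF lipZ sub(2)] der] by simp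
qed

end

section \<open>The maximum principle as a sufficient condition\<close>

text \<open>Since \<open>z' = x\<^sup>2 / 2 u2\<close>, this is the coefficient of \<open>u2\<close> in the pairing of the
  covector with components \<open>a\<close>, \<open>c\<close> along \<open>dy\<close>, \<open>dz\<close> with the velocity, as a function of the
  position \<open>s\<close> on the \<open>x\<close>-axis.\<close>
definition momentum :: "real \<Rightarrow> real \<Rightarrow> real \<Rightarrow> real" where
  "momentum a c s = a + c * s\<^sup>2 / 2"

text \<open>This is the maximum of \<open>\<epsilon> sqrt (u1\<^sup>2 - u2\<^sup>2) + momentum a c s * u2\<close> over the controls
  with \<open>u1 = 1\<close>, for \<open>\<epsilon> \<ge> 0\<close>. The multiplier \<open>\<epsilon>\<close> of the length is \<open>1\<close> for normal and \<open>0\<close> for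
  abnormal extremals.\<close>
definition hamiltonian :: "real \<Rightarrow> real \<Rightarrow> real \<Rightarrow> real \<Rightarrow> real" where
  "hamiltonian \<epsilon> a c s = sqrt (\<epsilon>\<^sup>2 + (momentum a c s)\<^sup>2)"

lemma continuous_on_momentum [continuous_intros]:
  "continuous_on S f \<Longrightarrow> continuous_on S (\<lambda>s. momentum a c (f s))"
  unfolding momentum_def by (intro continuous_intros) auto

lemma continuous_on_hamiltonian [continuous_intros]:
  "continuous_on S f \<Longrightarrow> continuous_on S (\<lambda>s. hamiltonian \<epsilon> a c (f s))"
  unfolding hamiltonian_def by (intro continuous_intros)

text \<open>The vector \<open>(sqrt (u\<^sup>2 - v\<^sup>2), v)\<close> has Euclidean norm \<open>u\<close>; this is the Cauchy--Schwarz
  inequality for its scalar product with \<open>(\<epsilon>, p)\<close>, together with the case of equality.\<close>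
lemma lorentz_cauchy_schwarz:
  fixes \<epsilon> p u v :: real
  assumes "\<bar>v\<bar> \<le> u"
  shows "\<epsilon> * sqrt (u\<^sup>2 - v\<^sup>2) + p * v \<le> sqrt (\<epsilon>\<^sup>2 + p\<^sup>2) * u"
    and "\<epsilon> * sqrt (u\<^sup>2 - v\<^sup>2) + p * v = sqrt (\<epsilon>\<^sup>2 + p\<^sup>2) * u \<Longrightarrow> \<epsilon>\<^sup>2 + p\<^sup>2 \<noteq> 0 \<Longrightarrow>
      v = p / sqrt (\<epsilon>\<^sup>2 + p\<^sup>2) * u"
proof -
  define w where "w = sqrt (u\<^sup>2 - v\<^sup>2)"
  define h where "h = sqrt (\<epsilon>\<^sup>2 + p\<^sup>2)"
  have "v\<^sup>2 \<le> u\<^sup>2"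
    using assms by (simp add: abs_le_square_iff[symmetric])
  then have w2: "w\<^sup>2 = u\<^sup>2 - v\<^sup>2"
    by (simp add: w_def)
  have h2: "h\<^sup>2 = \<epsilon>\<^sup>2 + p\<^sup>2" and h0: "0 \<le> h"
    by (simp_all add: h_def)
  have lagrange: "(\<epsilon> * w + p * v)\<^sup>2 + (\<epsilon> * v - p * w)\<^sup>2 = (h * u)\<^sup>2"
    using w2 h2 by algebra
  show "\<epsilon> * sqrt (u\<^sup>2 - v\<^sup>2) + p * v \<le> sqrt (\<epsilon>\<^sup>2 + p\<^sup>2) * u"
    unfolding w_def[symmetric] h_def[symmetric]
  proof (rule power2_le_imp_le)
    show "(\<epsilon> * w + p * v)\<^sup>2 \<le> (h * u)\<^sup>2"
      unfolding lagrange[symmetric] by simp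
    show "0 \<le> h * u" using h0 assms by simp
  qed
  assume "\<epsilon> * sqrt (u\<^sup>2 - v\<^sup>2) + p * v = sqrt (\<epsilon>\<^sup>2 + p\<^sup>2) * u" and nonzero: "\<epsilon>\<^sup>2 + p\<^sup>2 \<noteq> 0"
  then have eq: "\<epsilon> * w + p * v = h * u"
    by (simp add: w_def h_def)
  with lagrange have "\<epsilon> * v = p * w" by simp
  with eq have "h\<^sup>2 * v = p * (h * u)"
    using h2 by algebra
  moreover have "h \<noteq> 0" using nonzero h2 by auto
  ultimately have "v = p / h * u"
    by (simp add: power2_eq_square field_simps)
  then show "v = p / sqrt (\<epsilon>\<^sup>2 + p\<^sup>2) * u" by (simp add: h_def)
qed

context trajectory
begin

text \<open>The amount by which the control misses the maximum in the maximum principle.\<close>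
definition "gap \<epsilon> a c t = hamiltonian \<epsilon> a c (x t) * u1 t - momentum a c (x t) * u2 t
  - \<epsilon> * sqrt ((u1 t)\<^sup>2 - (u2 t)\<^sup>2)"

lemma AE_gap_nonneg: "AE t in lebesgue_on {0..t1}. 0 \<le> gap \<epsilon> a c t"
  using AE_control
proof eventually_elim
  case (elim t)
  then show ?case
    using lorentz_cauchy_schwarz(1)[of "u2 t" "u1 t" \<epsilon> "momentum a c (x t)"]
    by (simp add: gap_def hamiltonian_def)
qed

lemma length_integrable: "integrable (lebesgue_on {0..t1}) (\<lambda>t. sqrt ((u1 t)\<^sup>2 - (u2 t)\<^sup>2))"
proof -
  obtain L where L: "L-lipschitz_on {0..t1} x" by (rule lipschitz)
  have "AE t in lebesgue_on {0..t1}. (x has_real_derivative u1 t) (at t within {0..t1})"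
    using AE_control by eventually_elim auto
  from lipschitz_on_imp_integral_derivative(1)[OF t1_nonneg L u_measurable(1) this]
  show ?thesis
  proof (rule Bochner_Integration.integrable_bound)
    show "AE t in lebesgue_on {0..t1}. norm (sqrt ((u1 t)\<^sup>2 - (u2 t)\<^sup>2)) \<le> norm (u1 t)"
      using AE_control
    proof eventually_elim
      case (elim t)
      then have "(u2 t)\<^sup>2 \<le> (u1 t)\<^sup>2" by (intro power2_le_iff_abs_le[THEN iffD2]) auto
      moreover have "sqrt ((u1 t)\<^sup>2 - (u2 t)\<^sup>2) \<le> sqrt ((u1 t)\<^sup>2)"
        by (rule real_sqrt_le_mono) simp
      ultimately show ?case by simp
    qed
  qed simp
qed

text \<open>The first two terms of the gap are the derivative of
  \<open>primitive (hamiltonian \<epsilon> a c) (x t) - a * y t - c * z t\<close>.\<close>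
lemma integral_gap:
  "integrable (lebesgue_on {0..t1}) (gap \<epsilon> a c)"
  "integral\<^sup>L (lebesgue_on {0..t1}) (gap \<epsilon> a c) =
     primitive (hamiltonian \<epsilon> a c) (x t1) - a * y t1 - c * z t1 - \<epsilon> * slength t1 u"
proof -
  let ?M = "lebesgue_on {0..t1}"
  let ?\<Phi> = "\<lambda>t. primitive (hamiltonian \<epsilon> a c) (x t) - a * y t - c * z t"
  let ?\<phi> = "\<lambda>t. hamiltonian \<epsilon> a c (x t) * u1 t - momentum a c (x t) * u2 t"
  have hamiltonian: "continuous_on UNIV (hamiltonian \<epsilon> a c)"
    by (intro continuous_intros)
  obtain L where L: "L-lipschitz_on {0..t1} y" "L-lipschitz_on {0..t1} z"
    using lipschitz by metis
  obtain K where K: "K-lipschitz_on {0..x t1} (primitive (hamiltonian \<epsilon> a c))"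
    by (rule lipschitz_on_primitive[OF hamiltonian])
  obtain K' where K': "K'-lipschitz_on {0..t1} (\<lambda>t. primitive (hamiltonian \<epsilon> a c) (x t))"
    by (rule lipschitz_compose_x[OF K])
  have lip: "(K' + \<bar>a\<bar> * L + \<bar>c\<bar> * L)-lipschitz_on {0..t1} ?\<Phi>"
    by (intro lipschitz_intros K' L)
  have [measurable]: "(\<lambda>t. hamiltonian \<epsilon> a c (x t)) \<in> borel_measurable ?M"
    "(\<lambda>t. momentum a c (x t)) \<in> borel_measurable ?M"
    by (intro continuous_imp_measurable_on_sets_lebesgue continuous_intros x_continuous; simp)+
  have meas: "?\<phi> \<in> borel_measurable ?M" by measurable
  have der: "AE t in ?M. (?\<Phi> has_real_derivative ?\<phi> t) (at t within {0..t1})"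
    using AE_control AE_chain[OF K DERIV_primitive[OF hamiltonian]]
  proof eventually_elim
    case (elim t)
    then show ?case
      by (auto intro!: derivative_eq_intros simp: momentum_def algebra_simps)
  qed
  note I = lipschitz_on_imp_integral_derivative[OF t1_nonneg lip meas der]
  have gap: "gap \<epsilon> a c = (\<lambda>t. ?\<phi> t - \<epsilon> * sqrt ((u1 t)\<^sup>2 - (u2 t)\<^sup>2))"
    by (simp add: gap_def fun_eq_iff)
  show "integrable ?M (gap \<epsilon> a c)"
    unfolding gap using I(1) length_integrable by auto
  have "slength t1 u = integral\<^sup>L ?M (\<lambda>t. sqrt ((u1 t)\<^sup>2 - (u2 t)\<^sup>2))"
    by (simp add: slength_def u1_def u2_def)
  then show "integral\<^sup>L ?M (gap \<epsilon> a c) =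
     primitive (hamiltonian \<epsilon> a c) (x t1) - a * y t1 - c * z t1 - \<epsilon> * slength t1 u"
    unfolding gap using I length_integrable by simp
qed

text \<open>The right-hand side and the terms in \<open>y\<close> and \<open>z\<close> depend on the endpoint only, so a
  trajectory that attains equality with \<open>\<epsilon> = 1\<close> is optimal.\<close>
lemma length_le:
  "\<epsilon> * slength t1 u + a * y t1 + c * z t1 \<le> primitive (hamiltonian \<epsilon> a c) (x t1)"
  using integral_nonneg_AE[OF AE_gap_nonneg, of \<epsilon> a c] integral_gap(2)[of \<epsilon> a c] by linarith

lemma length_eq_imp_feedback:
  assumes eq: "\<epsilon> * slength t1 u + a * y t1 + c * z t1 = primitive (hamiltonian \<epsilon> a c) (x t1)"
    and nonzero: "\<And>s. 0 \<le> s \<Longrightarrow> s \<noteq> \<tau> \<Longrightarrow> hamiltonian \<epsilon> a c s \<noteq> 0"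
  shows "AE t in lebesgue_on {0..t1}. x t \<noteq> \<tau> \<longrightarrow>
      u2 t = momentum a c (x t) / hamiltonian \<epsilon> a c (x t) * u1 t"
proof -
  have "integral\<^sup>L (lebesgue_on {0..t1}) (gap \<epsilon> a c) = 0"
    using eq integral_gap(2)[of \<epsilon> a c] by simp
  then have "AE t in lebesgue_on {0..t1}. gap \<epsilon> a c t = 0"
    using integral_nonneg_eq_0_iff_AE[OF integral_gap(1) AE_gap_nonneg] by blast
  with AE_control show ?thesis
  proof eventually_elim
    case (elim t)
    show ?case
    proof
      assume "x t \<noteq> \<tau>"
      then have "hamiltonian \<epsilon> a c (x t) \<noteq> 0"
        using nonzero x_range[of t] elim by auto
      then show "u2 t = momentum a c (x t) / hamiltonian \<epsilon> a c (x t) * u1 t"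
        using elim lorentz_cauchy_schwarz(2)[of "u2 t" "u1 t" \<epsilon> "momentum a c (x t)"]
        by (simp add: gap_def hamiltonian_def)
    qed
  qed
qed

text \<open>\<open>g\<close> is the time at which the reference curve \<open>\<Gamma>\<close> passes a given value of \<open>x\<close>.\<close>
lemma reparametrization_of_graph:
  assumes q: "\<And>t. t \<in> {0..t1} \<Longrightarrow> q t = \<Gamma> (g (x t))"
    and g: "continuous_on {0..x t1} g" "mono_on {0..x t1} g" "g 0 = 0"
  shows "reparametrization_of (g (x t1)) \<Gamma> t1 q"
  unfolding reparametrization_of_def
proof (intro exI[of _ "\<lambda>t. g (x t)"] conjI ballI)
  show cont: "continuous_on {0..t1} (\<lambda>t. g (x t))"
    by (rule continuous_on_compose2[OF g(1) x_continuous]) (use x_range in auto)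
  have mono: "g (x s) \<le> g (x t)" if "0 \<le> s" "s \<le> t" "t \<le> t1" for s t
    using that x_mono[of s t] x_range[of s] x_range[of t] by (intro mono_onD[OF g(2)]) auto
  then show "mono_on {0..t1} (\<lambda>t. g (x t))"
    by (auto intro!: mono_onI)
  show "(\<lambda>t. g (x t)) ` {0..t1} = {0..g (x t1)}"
  proof (intro equalityI subsetI)
    fix r assume "r \<in> (\<lambda>t. g (x t)) ` {0..t1}"
    then show "r \<in> {0..g (x t1)}"
      using mono[of 0] mono[of _ t1] g(3) t1_nonneg by auto
  next
    fix r assume "r \<in> {0..g (x t1)}"
    then show "r \<in> (\<lambda>t. g (x t)) ` {0..t1}"
      using IVT'[of "\<lambda>t. g (x t)" 0 r t1] cont g(3) t1_nonneg by auto
  qed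
qed (use q in auto)

end

section \<open>Bang-bang extremals\<close>

text \<open>Position as a function of \<open>s = x\<close> for the slope \<open>\<sigma>\<close> before \<open>s = \<tau>\<close> and \<open>- \<sigma>\<close> after it.
  One formula for both phases shows the Lipschitz property at the corner without a case
  distinction.\<close>
definition bang_y :: "real \<Rightarrow> real \<Rightarrow> real \<Rightarrow> real" where
  "bang_y \<sigma> \<tau> s = \<sigma> * (\<tau> - \<bar>s - \<tau>\<bar>)"

definition bang_z :: "real \<Rightarrow> real \<Rightarrow> real \<Rightarrow> real" where
  "bang_z \<sigma> \<tau> s = \<sigma> * (\<tau>^3 - \<bar>s^3 - \<tau>^3\<bar>) / 6"

lemma cube_le_iff: "(s::real)^3 \<le> \<tau>^3 \<longleftrightarrow> s \<le> \<tau>"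
  by (metis odd_numeral odd_real_root_power_cancel real_root_le_iff zero_less_numeral)

lemma bang_before: "s \<le> \<tau> \<Longrightarrow> bang_y \<sigma> \<tau> s = \<sigma> * s" "s \<le> \<tau> \<Longrightarrow> bang_z \<sigma> \<tau> s = \<sigma> * s^3 / 6"
  using cube_le_iff[of s \<tau>] by (auto simp: bang_y_def bang_z_def)

lemma bang_after:
  "\<tau> \<le> s \<Longrightarrow> bang_y \<sigma> \<tau> s = \<sigma> * (2 * \<tau> - s)"
  "\<tau> \<le> s \<Longrightarrow> bang_z \<sigma> \<tau> s = \<sigma> * (2 * \<tau>^3 - s^3) / 6"
  using cube_le_iff[of \<tau> s] by (auto simp: bang_y_def bang_z_def)

lemma DERIV_bang:
  assumes "s \<noteq> \<tau>"
  shows "(bang_y \<sigma> \<tau> has_real_derivative \<sigma> * sgn (\<tau> - s)) (at s)"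
    and "(bang_z \<sigma> \<tau> has_real_derivative s\<^sup>2 / 2 * (\<sigma> * sgn (\<tau> - s))) (at s)"
proof -
  define S where "S = (if s < \<tau> then {..<\<tau>} else {\<tau><..})"
  have S: "open S" "s \<in> S" using assms by (auto simp: S_def)
  define \<theta> where "\<theta> = sgn (\<tau> - s)"
  have "((\<lambda>s. \<sigma> * (\<tau> + \<theta> * (s - \<tau>))) has_real_derivative \<sigma> * \<theta>) (at s)"
    by (auto intro!: derivative_eq_intros)
  then have "(bang_y \<sigma> \<tau> has_real_derivative \<sigma> * \<theta>) (at s)"
    by (rule has_field_derivative_transform_within_open[OF _ S])
      (use assms in \<open>auto simp: S_def \<theta>_def bang_before bang_after algebra_simps split: if_splits\<close>)
  then show "(bang_y \<sigma> \<tau> has_real_derivative \<sigma> * sgn (\<tau> - s)) (at s)"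
    by (simp only: \<theta>_def)
  have "((\<lambda>s. \<sigma> * (\<tau>^3 + \<theta> * (s^3 - \<tau>^3)) / 6) has_real_derivative s\<^sup>2 / 2 * (\<sigma> * \<theta>)) (at s)"
    by (auto intro!: derivative_eq_intros)
  then have "(bang_z \<sigma> \<tau> has_real_derivative s\<^sup>2 / 2 * (\<sigma> * \<theta>)) (at s)"
    by (rule has_field_derivative_transform_within_open[OF _ S])
      (use assms in \<open>auto simp: S_def \<theta>_def bang_before bang_after algebra_simps split: if_splits\<close>)
  then show "(bang_z \<sigma> \<tau> has_real_derivative s\<^sup>2 / 2 * (\<sigma> * sgn (\<tau> - s))) (at s)"
    by (simp only: \<theta>_def)
qed

lemma lipschitz_bang:
  obtains K where "K-lipschitz_on {a..b} (bang_y \<sigma> \<tau>)" "K-lipschitz_on {a..b} (bang_z \<sigma> \<tau>)"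
proof -
  obtain C where C: "C-lipschitz_on {a..b} (\<lambda>s::real. s^3)"
    by (rule lipschitz_on_Icc_if_DERIV[of a b "\<lambda>s. s^3" "\<lambda>s. 3 * s\<^sup>2"])
      (auto intro!: derivative_eq_intros continuous_intros)
  have C0: "0 \<le> C" by (rule lipschitz_on_nonneg[OF C])
  have 1: "\<bar>\<sigma>\<bar>-lipschitz_on {a..b} (bang_y \<sigma> \<tau>)"
  proof (rule lipschitz_onI)
    fix r s :: real
    have "dist (bang_y \<sigma> \<tau> r) (bang_y \<sigma> \<tau> s) = \<bar>\<sigma>\<bar> * \<bar>\<bar>s - \<tau>\<bar> - \<bar>r - \<tau>\<bar>\<bar>"
      by (simp add: bang_y_def dist_real_def abs_mult[symmetric] algebra_simps)
    also have "\<dots> \<le> \<bar>\<sigma>\<bar> * dist r s"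
      by (intro mult_left_mono) (auto simp: dist_real_def)
    finally show "dist (bang_y \<sigma> \<tau> r) (bang_y \<sigma> \<tau> s) \<le> \<bar>\<sigma>\<bar> * dist r s" .
  qed simp
  have 2: "(\<bar>\<sigma>\<bar> / 6 * C)-lipschitz_on {a..b} (bang_z \<sigma> \<tau>)"
  proof (rule lipschitz_onI)
    fix r s :: real assume rs: "r \<in> {a..b}" "s \<in> {a..b}"
    have "bang_z \<sigma> \<tau> r - bang_z \<sigma> \<tau> s = \<sigma> / 6 * (\<bar>s^3 - \<tau>^3\<bar> - \<bar>r^3 - \<tau>^3\<bar>)"
      by (simp add: bang_z_def algebra_simps diff_divide_distrib)
    then have "dist (bang_z \<sigma> \<tau> r) (bang_z \<sigma> \<tau> s) = \<bar>\<sigma>\<bar> / 6 * \<bar>\<bar>s^3 - \<tau>^3\<bar> - \<bar>r^3 - \<tau>^3\<bar>\<bar>"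
      unfolding dist_real_def by (simp only: abs_mult abs_divide abs_numeral)
    also have "\<dots> \<le> \<bar>\<sigma>\<bar> / 6 * dist (r^3) (s^3)"
      by (intro mult_left_mono) (auto simp: dist_real_def)
    also have "\<dots> \<le> \<bar>\<sigma>\<bar> / 6 * (C * dist r s)"
      by (intro mult_left_mono lipschitz_onD[OF C] rs) auto
    finally show "dist (bang_z \<sigma> \<tau> r) (bang_z \<sigma> \<tau> s) \<le> \<bar>\<sigma>\<bar> / 6 * C * dist r s"
      by (simp add: mult.assoc)
  qed (use C0 in simp)
  show ?thesis
    by (rule that[of "max \<bar>\<sigma>\<bar> (\<bar>\<sigma>\<bar> / 6 * C)"])
        (auto intro: lipschitz_on_mono[OF 1] lipschitz_on_mono[OF 2])
qed

text \<open>The momentum \<open>\<sigma> (\<tau>\<^sup>2 - s\<^sup>2) / 2\<close> vanishes for \<open>s \<ge> 0\<close> only at the switching point, and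
  elsewhere its sign is the control: the bang-bang curve satisfies the maximum principle
  with \<open>\<epsilon> = 0\<close>.\<close>
lemma momentum_bang:
  assumes "\<sigma> \<in> {1, -1}" "0 \<le> \<tau>" "0 \<le> s"
  shows "momentum (\<sigma> * \<tau>\<^sup>2 / 2) (- \<sigma>) s * (\<sigma> * sgn (\<tau> - s)) = hamiltonian 0 (\<sigma> * \<tau>\<^sup>2 / 2) (- \<sigma>) s"
    and "s \<noteq> \<tau> \<Longrightarrow> hamiltonian 0 (\<sigma> * \<tau>\<^sup>2 / 2) (- \<sigma>) s \<noteq> 0"
    and "s \<noteq> \<tau> \<Longrightarrow>
        momentum (\<sigma> * \<tau>\<^sup>2 / 2) (- \<sigma>) s / hamiltonian 0 (\<sigma> * \<tau>\<^sup>2 / 2) (- \<sigma>) s = \<sigma> * sgn (\<tau> - s)"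
proof -
  let ?m = "momentum (\<sigma> * \<tau>\<^sup>2 / 2) (- \<sigma>) s" and ?h = "hamiltonian 0 (\<sigma> * \<tau>\<^sup>2 / 2) (- \<sigma>) s"
  have m: "?m = \<sigma> * ((\<tau> + s) / 2) * (\<tau> - s)"
    by (simp add: momentum_def power2_eq_square field_simps)
  have h: "?h = \<bar>?m\<bar>" by (simp add: hamiltonian_def)
  have \<sigma>: "\<sigma> * \<sigma> = 1" "\<bar>\<sigma>\<bar> = 1" using assms(1) by auto
  have "?m * (\<sigma> * sgn (\<tau> - s)) = (\<sigma> * \<sigma>) * ((\<tau> + s) / 2) * ((\<tau> - s) * sgn (\<tau> - s))"
    by (simp add: m)
  also have "\<dots> = ?h"
    unfolding h m \<sigma> using assms by (simp add: abs_mult \<sigma> mult_sgn_abs abs_sgn[symmetric])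
  finally show 1: "?m * (\<sigma> * sgn (\<tau> - s)) = ?h" .
  assume ne: "s \<noteq> \<tau>"
  with assms have pos: "0 < \<tau> + s" by linarith
  show nonzero: "?h \<noteq> 0" unfolding h m using \<sigma> ne pos by auto
  have "(\<sigma> * sgn (\<tau> - s)) * (\<sigma> * sgn (\<tau> - s)) = 1"
    using \<sigma> ne by (auto simp: sgn_if)
  then have "?m = ?h * (\<sigma> * sgn (\<tau> - s))"
    using 1 by (metis mult.assoc mult.right_neutral)
  then show "?m / ?h = \<sigma> * sgn (\<tau> - s)" using nonzero by simp
qed

locale bang_bang =
  fixes \<sigma> \<tau> X :: real and q :: "real \<Rightarrow> point"
  assumes \<sigma>: "\<sigma> \<in> {1, -1}" and \<tau>: "0 \<le> \<tau>" "\<tau> \<le> X"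
    and q: "\<And>t. t \<in> {0..X} \<Longrightarrow> q t = (t, bang_y \<sigma> \<tau> t, bang_z \<sigma> \<tau> t)"
begin

abbreviation "u \<equiv> switched_control (1, \<sigma>) (1, - \<sigma>) \<tau>"

lemma corresponds: "corresponds_to_control X q u"
  unfolding corresponds_to_control_def
proof (intro conjI ballI)
  have [measurable]: "(\<lambda>t. t) \<in> borel_measurable (lebesgue_on {0..X})"
    using id_borel_measurable_lebesgue_on by (simp add: id_def)
  show "u \<in> borel_measurable (lebesgue_on {0..X})"
    unfolding switched_control_def by measurable
  show "u t \<in> U2" for t
    using \<sigma> by (auto simp: switched_control_def U2_def)
  have "AE t in lebesgue_on {0..X}. t \<notin> {\<tau>}"
    by (rule AE_lebesgue_on_notin_countable) auto
  with AE_space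
  show "AE t in lebesgue_on {0..X}. (q has_vector_derivative
      fst (u t) *\<^sub>R X1 (q t) + snd (u t) *\<^sub>R X2 (q t)) (at t within {0..X})"
  proof eventually_elim
    case (elim t)
    then have t: "t \<in> {0..X}" "t \<noteq> \<tau>" by auto
    have u: "fst (u t) = 1" "snd (u t) = \<sigma> * sgn (\<tau> - t)"
      using t by (auto simp: switched_control_def)
    have "((\<lambda>t. (t, bang_y \<sigma> \<tau> t, bang_z \<sigma> \<tau> t)) has_vector_derivative
        (1, \<sigma> * sgn (\<tau> - t), t\<^sup>2 / 2 * (\<sigma> * sgn (\<tau> - t)))) (at t)"
      using DERIV_bang[OF t(2)]
      by (intro has_vector_derivative_Pair has_vector_derivative_id)
        (auto simp: has_real_derivative_iff_has_vector_derivative)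
    then have "((\<lambda>t. (t, bang_y \<sigma> \<tau> t, bang_z \<sigma> \<tau> t)) has_vector_derivative
        (1, \<sigma> * sgn (\<tau> - t), t\<^sup>2 / 2 * (\<sigma> * sgn (\<tau> - t)))) (at t within {0..X})"
      by (rule has_vector_derivative_at_within)
    then have "(q has_vector_derivative
        (1, \<sigma> * sgn (\<tau> - t), t\<^sup>2 / 2 * (\<sigma> * sgn (\<tau> - t)))) (at t within {0..X})"
      by (rule has_vector_derivative_transform[rotated 2]) (use t q in auto)
    then show ?case
      by (simp add: u q[OF t(1)] X1_def X2_def mult.commute)
  qed
qed

sublocale trajectory X q u
proof unfold_locales
  obtain K where K: "K-lipschitz_on {0..X} (bang_y \<sigma> \<tau>)" "K-lipschitz_on {0..X} (bang_z \<sigma> \<tau>)"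
    by (rule lipschitz_bang)
  have "\<exists>L. L-lipschitz_on {0..X} q"
    using lipschitz_on_transform[OF lipschitz_on_Pair[OF lipschitz_on_id lipschitz_on_Pair[OF K]],
        of q] q
    by metis
  then show "admissible X q u"
    using corresponds \<tau> by (simp add: admissible_def)
  show "q 0 = q0"
    using q[of 0] \<tau> by (simp add: q0_def bang_before)
qed

lemma coordinates: "t \<in> {0..X} \<Longrightarrow> x t = t" "t \<in> {0..X} \<Longrightarrow> y t = bang_y \<sigma> \<tau> t"
    "t \<in> {0..X} \<Longrightarrow> z t = bang_z \<sigma> \<tau> t"
  by (simp_all add: x_def y_def z_def q)

lemma slength_0: "slength X u = 0"
  using \<sigma> unfolding slength_def
  by (intro integral_eq_zero_AE AE_I2) (auto simp: switched_control_def)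

text \<open>The gap of the bang-bang curve itself vanishes almost everywhere, which gives equality
  in \<open>length_le\<close> with \<open>\<epsilon> = 0\<close>.\<close>
lemma primitive_hamiltonian: "primitive (hamiltonian 0 (\<sigma> * \<tau>\<^sup>2 / 2) (- \<sigma>)) X =
    \<sigma> * \<tau>\<^sup>2 / 2 * bang_y \<sigma> \<tau> X + (- \<sigma>) * bang_z \<sigma> \<tau> X"
proof -
  let ?a = "\<sigma> * \<tau>\<^sup>2 / 2" and ?c = "- \<sigma>"
  have "AE t in lebesgue_on {0..X}. t \<notin> {\<tau>}"
    by (rule AE_lebesgue_on_notin_countable) auto
  with AE_space have "AE t in lebesgue_on {0..X}. gap 0 ?a ?c t = 0"
  proof eventually_elim
    case (elim t)
    then have t: "t \<in> {0..X}" "t \<noteq> \<tau>" by auto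
    have "u1 t = 1" "u2 t = \<sigma> * sgn (\<tau> - t)"
      using t by (auto simp: switched_control_def u1_def u2_def)
    then show ?case
      using t momentum_bang(1)[OF \<sigma> \<tau>(1), of t] by (simp add: gap_def coordinates)
  qed
  then have "integral\<^sup>L (lebesgue_on {0..X}) (gap 0 ?a ?c) = 0"
    by (rule integral_eq_zero_AE)
  then show ?thesis
    using integral_gap(2)[of 0 ?a ?c] coordinates[of X] \<tau> by simp
qed

text \<open>Equality in \<open>length_le\<close> with \<open>\<epsilon> = 0\<close> depends on the endpoint only, so every trajectory
  to the same endpoint obeys the same feedback.\<close>
lemma competitor:
  assumes "trajectory T p v" "p T = q X"
  shows "slength T v = 0" "reparametrization_of X q T p"
proof -
  interpret p: trajectory T p v by fact
  let ?a = "\<sigma> * \<tau>\<^sup>2 / 2" and ?c = "- \<sigma>"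
  have X: "X \<in> {0..X}" using \<tau> by auto
  have end_p: "p.x T = X" "p.y T = bang_y \<sigma> \<tau> X" "p.z T = bang_z \<sigma> \<tau> X"
    using assms(2) q[OF X] by (simp_all add: p.q_eq)
  have "AE t in lebesgue_on {0..T}. p.x t \<noteq> \<tau> \<longrightarrow>
      p.u2 t = momentum ?a ?c (p.x t) / hamiltonian 0 ?a ?c (p.x t) * p.u1 t"
    by (rule p.length_eq_imp_feedback)
        (use primitive_hamiltonian momentum_bang(2)[OF \<sigma> \<tau>(1)] end_p in auto)
  with p.AE_control have fb: "AE t in lebesgue_on {0..T}. p.x t \<noteq> \<tau> \<longrightarrow>
      p.u2 t = \<sigma> * sgn (\<tau> - p.x t) * p.u1 t"
  proof eventually_elim
    case (elim t)
    then show ?case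
      using momentum_bang(3)[OF \<sigma> \<tau>(1), of "p.x t"] p.x_range[of t] by (metis atLeastAtMost_iff)
  qed
  have "AE t in lebesgue_on {0..T}. sqrt ((p.u1 t)\<^sup>2 - (p.u2 t)\<^sup>2) = 0"
    using fb p.AE_level_stationary[of \<tau>]
  proof eventually_elim
    case (elim t)
    then show ?case
      using \<sigma> by (cases "p.x t = \<tau>") (auto simp: sgn_if)
  qed
  then show "slength T v = 0"
    unfolding slength_def p.u1_def p.u2_def by (rule integral_eq_zero_AE)
  obtain K where K: "K-lipschitz_on {0..X} (bang_y \<sigma> \<tau>)" "K-lipschitz_on {0..X} (bang_z \<sigma> \<tau>)"
    by (rule lipschitz_bang)
  have "p t = q (p.x t)" if "t \<in> {0..T}" for t
  proof -
    have "p t = (p.x t, bang_y \<sigma> \<tau> (p.x t), bang_z \<sigma> \<tau> (p.x t))"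
      by (rule p.graph_of_feedback[OF fb _ _ DERIV_bang])
        (use K end_p that \<tau> in \<open>auto simp: bang_before\<close>)
    then show ?thesis
      using q[of "p.x t"] p.x_range[OF that] end_p by simp
  qed
  from p.reparametrization_of_graph[of q "\<lambda>s. s", OF this] show "reparametrization_of X q T p"
    by (simp add: end_p mono_on_def)
qed

lemma unique_optimal: "unique_optimal (X, bang_y \<sigma> \<tau> X, bang_z \<sigma> \<tau> X) X q"
  unfolding unique_optimal_def
proof (intro conjI allI impI)
  show "optimal X q"
    unfolding optimal_def
    using adm start slength_0 competitor(1) by (metis order_refl trajectory.intro)
  show "q 0 = q0" "q X = (X, bang_y \<sigma> \<tau> X, bang_z \<sigma> \<tau> X)"
    using start q \<tau> by auto
  show "reparametrization_of X q T p"
    if "optimal T p \<and> p 0 = q0 \<and> p T = (X, bang_y \<sigma> \<tau> X, bang_z \<sigma> \<tau> X)" for T p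
    using that q \<tau> unfolding optimal_def
    by (metis atLeastAtMost_iff competitor(2) order_refl order_trans trajectory.intro)
qed

end

section \<open>Flows\<close>

lemma flow_at_nonneg:
  assumes t: "0 \<le> t"
    and ex: "\<Gamma> 0 = p" "\<And>s. s \<in> {0..t} \<Longrightarrow> (\<Gamma> has_vector_derivative F (\<Gamma> s)) (at s within {0..t})"
    and uniq: "\<And>\<gamma>. \<gamma> 0 = p \<Longrightarrow>
      (\<And>s. s \<in> {0..t} \<Longrightarrow> (\<gamma> has_vector_derivative F (\<gamma> s)) (at s within {0..t})) \<Longrightarrow> \<gamma> t = \<Gamma> t"
  shows "flow F t p = \<Gamma> t"
proof -
  have "closed_segment 0 t = {0..t}" using t by (simp add: closed_segment_eq_real_ivl)
  then show ?thesis
    unfolding flow_def using ex uniq by (intro the_equality) (metis (no_types))+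
qed

text \<open>All uniqueness statements for flows below reduce to this lemma, because their vector
  fields can be integrated one coordinate at a time, for the normal extremals with the help
  of a first integral.\<close>
lemma eq_if_same_derivative:
  fixes f g :: "real \<Rightarrow> real"
  assumes "\<And>s. s \<in> {0..t} \<Longrightarrow> (f has_real_derivative h s) (at s within {0..t})"
    and "\<And>s. s \<in> {0..t} \<Longrightarrow> (g has_real_derivative h s) (at s within {0..t})"
    and "f 0 = g 0" "r \<in> {0..t}"
  shows "f r = g r"
proof -
  have "((\<lambda>s. f s - g s) has_real_derivative 0) (at s within {0..t})" if "s \<in> {0..t}" for s
    using assms(1,2)[OF that] by (auto intro!: derivative_eq_intros)
  then obtain c where "\<And>s. s \<in> {0..t} \<Longrightarrow> f s - g s = c"
    using has_field_derivative_zero_constant[of "{0..t}" "\<lambda>s. f s - g s"] by auto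
  from this[of 0] this[of r] show ?thesis using assms by auto
qed

lemma has_vector_derivative_Pair_iff:
  "((\<lambda>s. (f s, g s)) has_vector_derivative (a, b)) (at x within S) \<longleftrightarrow>
     (f has_vector_derivative a) (at x within S) \<and> (g has_vector_derivative b) (at x within S)"
  using bounded_linear.has_vector_derivative[OF bounded_linear_fst, of "\<lambda>s. (f s, g s)" "(a,b)"]
    bounded_linear.has_vector_derivative[OF bounded_linear_snd, of "\<lambda>s. (f s, g s)" "(a,b)"]
  by (auto intro: has_vector_derivative_Pair)

lemma flow_constant_control:
  assumes t: "0 \<le> t" and F: "\<And>x y z. F (x, y, z) = (1, \<sigma>, \<sigma> * x\<^sup>2 / 2)"
  shows "flow F t (a, b, c) = (a + t, b + \<sigma> * t, c + \<sigma> * ((a + t)^3 - a^3) / 6)"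
proof -
  define \<Gamma> where "\<Gamma> s = (a + s, b + \<sigma> * s, c + \<sigma> * ((a + s)^3 - a^3) / 6)" for s
  have "flow F t (a, b, c) = \<Gamma> t"
  proof (rule flow_at_nonneg[OF t])
    show "\<Gamma> 0 = (a, b, c)" by (simp add: \<Gamma>_def)
    show "(\<Gamma> has_vector_derivative F (\<Gamma> s)) (at s within {0..t})" for s
      unfolding \<Gamma>_def F has_vector_derivative_Pair_iff
      by (auto simp: has_real_derivative_iff_has_vector_derivative[symmetric]
          intro!: derivative_eq_intros)
  next
    fix \<gamma> assume \<gamma>: "\<gamma> 0 = (a, b, c)"
      "\<And>s. s \<in> {0..t} \<Longrightarrow> (\<gamma> has_vector_derivative F (\<gamma> s)) (at s within {0..t})"
    define x y z where "x s = fst (\<gamma> s)" and "y s = fst (snd (\<gamma> s))"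
        and "z s = snd (snd (\<gamma> s))" for s
    have \<gamma>_eq: "\<gamma> = (\<lambda>s. (x s, y s, z s))" by (simp add: x_def y_def z_def)
    have der: "(x has_real_derivative 1) (at s within {0..t})"
      "(y has_real_derivative \<sigma>) (at s within {0..t})"
      "(z has_real_derivative \<sigma> * (x s)\<^sup>2 / 2) (at s within {0..t})" if "s \<in> {0..t}" for s
      using \<gamma>(2)[OF that] unfolding \<gamma>_eq F has_vector_derivative_Pair_iff
      by (auto simp: has_real_derivative_iff_has_vector_derivative)
    have init: "x 0 = a" "y 0 = b" "z 0 = c" using \<gamma>(1) by (auto simp: \<gamma>_eq)
    have x: "x s = a + s" if "s \<in> {0..t}" for s
      by (rule eq_if_same_derivative[OF der(1) _ _ that])
          (auto simp: init intro!: derivative_eq_intros)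
    have y: "y t = b + \<sigma> * t"
      by (rule eq_if_same_derivative[OF der(2)]) (auto simp: init t intro!: derivative_eq_intros)
    have z: "z t = c + \<sigma> * ((a + t)^3 - a^3) / 6"
      by (rule eq_if_same_derivative[OF der(3)]) (auto simp: init t x intro!: derivative_eq_intros)
    show "\<gamma> t = \<Gamma> t"
      using x[of t] y z t by (simp add: \<gamma>_eq \<Gamma>_def)
  qed
  then show ?thesis by (simp add: \<Gamma>_def)
qed

lemma switched_curve_eq_bang:
  assumes t: "0 \<le> t" and \<tau>: "0 \<le> \<tau>"
    and F: "\<And>x y z. F (x, y, z) = (1, \<sigma>, \<sigma> * x\<^sup>2 / 2)"
    and G: "\<And>x y z. G (x, y, z) = (1, - \<sigma>, - \<sigma> * x\<^sup>2 / 2)"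
  shows "switched_curve F G \<tau> t = (t, bang_y \<sigma> \<tau> t, bang_z \<sigma> \<tau> t)"
proof -
  have 1: "flow F s q0 = (s, \<sigma> * s, \<sigma> * s^3 / 6)" if "0 \<le> s" for s
    using flow_constant_control[OF that F] by (simp add: q0_def)
  have 2: "flow G (t - \<tau>) (\<tau>, b, c) = (t, b - \<sigma> * (t - \<tau>), c - \<sigma> * (t^3 - \<tau>^3) / 6)"
    if "\<tau> \<le> t" for b c
    using flow_constant_control[of "t - \<tau>" G "- \<sigma>", OF _ G] that by simp
  show ?thesis
    using t \<tau>
    by (auto simp: switched_curve_def 1 2 bang_before bang_after algebra_simps add_divide_distrib
        diff_divide_distrib)
qed

lemma plus_minusI:
  assumes "0 \<le> \<tau>" "\<tau> \<le> X"
  shows "plus_minus (X, 2 * \<tau> - X, (2 * \<tau>^3 - X^3) / 6) \<tau> X"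
proof -
  interpret bang_bang 1 \<tau> X "switched_curve X_plus X_minus \<tau>"
    by unfold_locales (use assms in \<open>auto intro!: switched_curve_eq_bang simp: X1_def X2_def\<close>)
  show ?thesis
    using corresponds unique_optimal assms by (simp add: plus_minus_def bang_after)
qed

lemma minus_plusI:
  assumes "0 \<le> \<tau>" "\<tau> \<le> X"
  shows "minus_plus (X, X - 2 * \<tau>, (X^3 - 2 * \<tau>^3) / 6) \<tau> X"
proof -
  interpret bang_bang "-1" \<tau> X "switched_curve X_minus X_plus \<tau>"
    by unfold_locales (use assms in \<open>auto intro!: switched_curve_eq_bang simp: X1_def X2_def\<close>)
  show ?thesis
    using corresponds unique_optimal assms by (simp add: minus_plus_def bang_after)
qed

section \<open>The attainable set is contained in a closed region\<close>

text \<open>The surface \<open>zb1\<close> is swept out by the endpoints of the bang-bang curves with \<open>\<sigma> = 1\<close>;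
  the switching time is determined by \<open>y = 2 \<tau> - x\<close>.\<close>
lemma lower_bang:
  assumes "\<bar>y\<bar> \<le> x"
  defines "\<tau> \<equiv> (x + y) / 2"
  shows "bang_bang 1 \<tau> x (\<lambda>t. (t, bang_y 1 \<tau> t, bang_z 1 \<tau> t))"
    and "bang_y 1 \<tau> x = y" "bang_z 1 \<tau> x = zb1 x y"
proof -
  show "bang_bang 1 \<tau> x (\<lambda>t. (t, bang_y 1 \<tau> t, bang_z 1 \<tau> t))"
    by unfold_locales (use assms(1) in \<open>auto simp: \<tau>_def\<close>)
  show "bang_y 1 \<tau> x = y" "bang_z 1 \<tau> x = zb1 x y"
    using assms(1) by (simp_all add: \<tau>_def bang_after zb1_def field_simps power_divide)
qed

lemma upper_bang:
  assumes "\<bar>y\<bar> \<le> x"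
  defines "\<tau> \<equiv> (x - y) / 2"
  shows "bang_bang (-1) \<tau> x (\<lambda>t. (t, bang_y (-1) \<tau> t, bang_z (-1) \<tau> t))"
    and "bang_y (-1) \<tau> x = y" "bang_z (-1) \<tau> x = zb2 x y"
proof -
  show "bang_bang (-1) \<tau> x (\<lambda>t. (t, bang_y (-1) \<tau> t, bang_z (-1) \<tau> t))"
    by unfold_locales (use assms(1) in \<open>auto simp: \<tau>_def\<close>)
  show "bang_y (-1) \<tau> x = y" "bang_z (-1) \<tau> x = zb2 x y"
    using assms(1) by (simp_all add: \<tau>_def bang_after zb2_def field_simps power_divide)
qed

definition A2_hull :: "point set" where
  "A2_hull = {(x, y, z). \<bar>y\<bar> \<le> x \<and> zb1 x y \<le> z \<and> z \<le> zb2 x y}"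

text \<open>The three inequalities are instances of \<open>length_le\<close> with \<open>\<epsilon> = 0\<close>: the covectors
  \<open>(\<plusminus>1, 0)\<close> give \<open>\<bar>y\<bar> \<le> x\<close>, and those of the bang-bang curves to the points above and below
  give the bounds for \<open>z\<close>.\<close>
lemma A2_subset_hull: "A2 \<subseteq> A2_hull"
proof
  fix p assume "p \<in> A2"
  then obtain T q u where "admissible T q u" "q 0 = q0" and p: "q T = p"
    by (auto simp: A2_def)
  then interpret trajectory T q u by unfold_locales
  define X Y Z where "X = x T" and "Y = y T" and "Z = z T"
  have "primitive (hamiltonian 0 a 0) X = \<bar>a\<bar> * X" for a
    by (rule primitive_eqI) (auto simp: hamiltonian_def momentum_def intro!: derivative_eq_intros)
  then have Y: "\<bar>Y\<bar> \<le> X"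
    using length_le[of 0 1 0] length_le[of 0 "-1" 0] by (simp add: X_def Y_def)
  have lower: "zb1 X Y \<le> Z"
  proof -
    interpret b: bang_bang 1 "(X + Y) / 2" X
        "\<lambda>t. (t, bang_y 1 ((X + Y) / 2) t, bang_z 1 ((X + Y) / 2) t)"
      by (rule lower_bang(1)[OF Y])
    show ?thesis
      using b.primitive_hamiltonian length_le[of 0 "1 * ((X + Y) / 2)\<^sup>2 / 2"
          "-1"] lower_bang(2,3)[OF Y]
      by (simp add: X_def Y_def Z_def)
  qed
  have upper: "Z \<le> zb2 X Y"
  proof -
    interpret b: bang_bang "-1" "(X - Y) / 2" X
        "\<lambda>t. (t, bang_y (-1) ((X - Y) / 2) t, bang_z (-1) ((X - Y) / 2) t)"
      by (rule upper_bang(1)[OF Y])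
    show ?thesis
      using b.primitive_hamiltonian length_le[of 0 "-1 * ((X - Y) / 2)\<^sup>2 / 2" 1]
          upper_bang(2,3)[OF Y]
      by (simp add: X_def Y_def Z_def)
  qed
  show "p \<in> A2_hull"
    using Y lower upper by (simp add: A2_hull_def p[symmetric] q_eq X_def Y_def Z_def)
qed

lemma frontier_A2_subset_hull: "frontier A2 \<subseteq> A2_hull"
proof -
  have "A2_hull = {p. \<bar>fst (snd p)\<bar> \<le> fst p} \<inter> {p. zb1 (fst p) (fst (snd p)) \<le> snd (snd p)}
      \<inter> {p. snd (snd p) \<le> zb2 (fst p) (fst (snd p))}"
    by (auto simp: A2_hull_def)
  moreover have "closed \<dots>"
    unfolding zb1_def zb2_def by (intro closed_Int closed_Collect_le continuous_intros) auto
  ultimately have "closure A2 \<subseteq> A2_hull"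
    using A2_subset_hull by (metis closure_minimal)
  then show ?thesis by (auto simp: frontier_def)
qed

section \<open>Normal extremals\<close>

lemma hamiltonian_1:
  "1 \<le> hamiltonian 1 a c s" "0 < hamiltonian 1 a c s"
      "(hamiltonian 1 a c s)\<^sup>2 = 1 + (momentum a c s)\<^sup>2" "\<bar>momentum a c s\<bar> \<le> hamiltonian 1 a c s"
proof -
  show 1: "1 \<le> hamiltonian 1 a c s" by (simp add: hamiltonian_def)
  then show "0 < hamiltonian 1 a c s" by linarith
  show "(hamiltonian 1 a c s)\<^sup>2 = 1 + (momentum a c s)\<^sup>2" by (simp add: hamiltonian_def)
  have "sqrt ((momentum a c s)\<^sup>2) \<le> hamiltonian 1 a c s" unfolding hamiltonian_def
      by (rule real_sqrt_le_mono) simp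
  then show "\<bar>momentum a c s\<bar> \<le> hamiltonian 1 a c s" by simp
qed

lemma hamiltonian_1_neq_0 [simp]: "hamiltonian 1 a c s \<noteq> 0"
  using hamiltonian_1(2)[of a c s] by simp

text \<open>The derivative \<open>dy / dx = tanh \<psi>\<close> along the normal extremal with
  \<open>sinh \<psi> = momentum a c x\<close>.\<close>
abbreviation slope :: "real \<Rightarrow> real \<Rightarrow> real \<Rightarrow> real" where
  "slope a c s \<equiv> momentum a c s / hamiltonian 1 a c s"

text \<open>Time and position on a normal extremal as functions of \<open>s = x\<close>, which is possible
  because \<open>x' = cosh \<psi> > 0\<close>. The parameter \<open>a\<close> is \<open>sinh \<psi>0\<close>.\<close>
definition normal_time :: "real \<Rightarrow> real \<Rightarrow> real \<Rightarrow> real" where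
  "normal_time a c = primitive (\<lambda>s. 1 / hamiltonian 1 a c s)"

definition normal_y :: "real \<Rightarrow> real \<Rightarrow> real \<Rightarrow> real" where
  "normal_y a c = primitive (\<lambda>s. slope a c s)"

definition normal_z :: "real \<Rightarrow> real \<Rightarrow> real \<Rightarrow> real" where
  "normal_z a c = primitive (\<lambda>s. s\<^sup>2 / 2 * slope a c s)"

lemma normal_0 [simp]: "normal_time a c 0 = 0" "normal_y a c 0 = 0" "normal_z a c 0 = 0"
  by (simp_all add: normal_time_def normal_y_def normal_z_def)

lemma continuous_on_normal_slope:
  "continuous_on S (\<lambda>s. 1 / hamiltonian 1 a c s)" "continuous_on S (\<lambda>s. slope a c s)"
  "continuous_on S (\<lambda>s. s\<^sup>2 / 2 * slope a c s)"
  by (intro continuous_intros; simp)+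

lemma DERIV_normal_time: "(normal_time a c has_real_derivative 1 / hamiltonian 1 a c s) (at s)"
  and DERIV_normal_y: "(normal_y a c has_real_derivative slope a c s) (at s)"
  and DERIV_normal_z: "(normal_z a c has_real_derivative s\<^sup>2 / 2 * slope a c s) (at s)"
  unfolding normal_time_def normal_y_def normal_z_def
  by (rule DERIV_primitive continuous_on_normal_slope)+

lemmas DERIV_normal = DERIV_normal_time DERIV_normal_y DERIV_normal_z

lemma normal_time_strict_mono: "strict_mono (normal_time a c)"
proof (rule strict_monoI)
  fix r s :: real assume "r < s"
  then show "normal_time a c r < normal_time a c s"
  proof (rule DERIV_pos_imp_increasing)
    show "\<exists>D. (normal_time a c has_real_derivative D) (at x) \<and> 0 < D" for x
      using DERIV_normal_time[of a c x] hamiltonian_1(2)[of a c x]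
      by (intro exI[of _ "1 / hamiltonian 1 a c x"]) simp
  qed
qed

lemma normal_time_less_iff [simp]: "normal_time a c r < normal_time a c s \<longleftrightarrow> r < s"
  and normal_time_le_iff [simp]: "normal_time a c r \<le> normal_time a c s \<longleftrightarrow> r \<le> s"
  and normal_time_eq_iff [simp]: "normal_time a c r = normal_time a c s \<longleftrightarrow> r = s"
  by (simp_all add: strict_mono_less strict_mono_less_eq strict_mono_eq normal_time_strict_mono)

lemma normal_time_sign [simp]: "0 < normal_time a c s \<longleftrightarrow> 0 < s" "0 \<le> normal_time a c s \<longleftrightarrow> 0 \<le> s"
  using normal_time_less_iff[of a c 0 s] normal_time_le_iff[of a c 0 s]
  by (simp_all del: normal_time_less_iff normal_time_le_iff)

lemma continuous_on_normal_time: "continuous_on S (normal_time a c)"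
  by (rule DERIV_continuous_on) (rule has_field_derivative_at_within[OF DERIV_normal_time])

definition normal_x :: "real \<Rightarrow> real \<Rightarrow> real \<Rightarrow> real" where
  "normal_x a c = inv (normal_time a c)"

lemma normal_x_normal_time [simp]: "normal_x a c (normal_time a c s) = s"
  unfolding normal_x_def by (simp add: inv_f_f inj_def)

lemma DERIV_normal_x:
  assumes "0 \<le> t" "t \<le> normal_time a c X"
  shows "(normal_x a c has_real_derivative hamiltonian 1 a c (normal_x a c t)) (at t)"
    and "normal_time a c (normal_x a c t) = t" "0 \<le> normal_x a c t" "normal_x a c t \<le> X"
proof -
  have "0 \<le> X" using assms normal_time_sign(2) order_trans by blast
  then obtain s where s: "0 \<le> s" "s \<le> X" "t = normal_time a c s"
    using IVT'[of "normal_time a c" 0 t X] assms continuous_on_normal_time by auto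
  then show "normal_time a c (normal_x a c t) = t" "0 \<le> normal_x a c t" "normal_x a c t \<le> X" by auto
  have "(normal_x a c has_derivative (*) (hamiltonian 1 a c s)) (at (normal_time a c s))"
  proof (rule has_derivative_inverse_strong[where f = "normal_time a c" and x = s and S = UNIV])
    show "(normal_time a c has_derivative (*) (1 / hamiltonian 1 a c s)) (at s)"
      using DERIV_normal_time[of a c s] by (simp only: has_field_derivative_def)
  qed (auto simp: continuous_on_normal_time fun_eq_iff)
  then show "(normal_x a c has_real_derivative hamiltonian 1 a c (normal_x a c t)) (at t)"
    using s by (simp add: has_field_derivative_def)
qed

text \<open>Writing the end time as \<open>normal_time a c X\<close> makes sure that the extremal has not blown
  up before.\<close>
lemma Exp_eq:
  assumes "0 \<le> X" "a = sinh \<psi>0"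
  shows "Exp ((\<psi>0, c), normal_time a c X) = (X, normal_y a c X, normal_z a c X)"
proof -
  let ?T = "normal_time a c X" and ?normal_x = "normal_x a c"
  define \<Gamma> where "\<Gamma> s =
    (arsinh (momentum a c (?normal_x s)), c, ?normal_x s, normal_y a c (?normal_x s), normal_z a c
        (?normal_x s))" for s
  have T: "0 \<le> ?T" using assms(1) by simp
  have "flow extremal_field ?T (\<psi>0, c, q0) = \<Gamma> ?T"
  proof (rule flow_at_nonneg[OF T])
    have "?normal_x 0 = 0" using normal_x_normal_time[of a c 0] by simp
    then show "\<Gamma> 0 = (\<psi>0, c, q0)"
      by (simp add: \<Gamma>_def momentum_def assms(2) arsinh_sinh_real q0_def)
  next
    fix s assume s: "s \<in> {0..?T}"
    let ?x = "?normal_x s"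
    have dx: "(?normal_x has_real_derivative hamiltonian 1 a c ?x) (at s)"
      by (rule DERIV_normal_x) (use s in auto)
    have d\<psi>: "((\<lambda>s. arsinh (momentum a c (?normal_x s))) has_real_derivative c * ?x) (at s)"
    proof -
      have "((\<lambda>s. momentum a c (?normal_x s))
          has_real_derivative c * ?x * hamiltonian 1 a c ?x) (at s)"
        unfolding momentum_def using dx by (auto intro!: derivative_eq_intros)
      from DERIV_chain2[where f = arsinh, OF arsinh_real_has_field_derivative this]
      have "((\<lambda>s. arsinh (momentum a c (?normal_x s))) has_real_derivative
          1 / hamiltonian 1 a c ?x * (c * ?x * hamiltonian 1 a c ?x)) (at s)"
        by (simp add: hamiltonian_def add.commute)
      then show ?thesis by simp
    qed
    have dy: "((\<lambda>s. normal_y a c (?normal_x s)) has_real_derivative momentum a c ?x) (at s)"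
      using DERIV_chain2[OF DERIV_normal_y[of a c] dx] by simp
    have dz: "((\<lambda>s. normal_z a c (?normal_x s))
        has_real_derivative ?x\<^sup>2 / 2 * momentum a c ?x) (at s)"
      using DERIV_chain2[OF DERIV_normal_z[of a c] dx] by simp
    have "(\<Gamma> has_vector_derivative
        (c * ?x, 0, hamiltonian 1 a c ?x, momentum a c ?x, ?x\<^sup>2 / 2 * momentum a c ?x)) (at s)"
      using dx d\<psi> dy dz unfolding \<Gamma>_def has_vector_derivative_Pair_iff
      by (simp add: has_real_derivative_iff_has_vector_derivative)
    moreover have "extremal_field (\<Gamma> s) =
        (c * ?x, 0, hamiltonian 1 a c ?x, momentum a c ?x, ?x\<^sup>2 / 2 * momentum a c ?x)"
      by (simp add: extremal_field_def \<Gamma>_def cosh_arsinh_real hamiltonian_def add.commute)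
    ultimately show "(\<Gamma> has_vector_derivative extremal_field (\<Gamma> s)) (at s within {0..?T})"
      by (auto intro: has_vector_derivative_at_within)
  next
    fix \<gamma> assume \<gamma>: "\<gamma> 0 = (\<psi>0, c, q0)" "\<And>s. s \<in> {0..?T} \<Longrightarrow>
      (\<gamma> has_vector_derivative extremal_field (\<gamma> s)) (at s within {0..?T})"
    \<comment> \<open>The first integral \<open>c x\<^sup>2 / 2 - sinh \<psi>\<close> determines \<open>\<psi>\<close> from \<open>x\<close>; then
      \<open>normal_time a c (x s) = s\<close>, so that \<open>x\<close>, and with it \<open>y\<close> and \<open>z\<close>, is the claimed
      function of time.\<close>
    define \<psi> k x y z where "\<psi> s = fst (\<gamma> s)" and "k s = fst (snd (\<gamma> s))"
      and "x s = fst (snd (snd (\<gamma> s)))" and "y s = fst (snd (snd (snd (\<gamma> s))))"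
      and "z s = snd (snd (snd (snd (\<gamma> s))))" for s
    have \<gamma>_eq: "\<gamma> = (\<lambda>s. (\<psi> s, k s, x s, y s, z s))"
      by (simp add: \<psi>_def k_def x_def y_def z_def)
    have der: "(\<psi> has_real_derivative k s * x s) (at s within {0..?T})"
      "(k has_real_derivative 0) (at s within {0..?T})"
      "(x has_real_derivative cosh (\<psi> s)) (at s within {0..?T})"
      "(y has_real_derivative sinh (\<psi> s)) (at s within {0..?T})"
      "(z has_real_derivative (x s)\<^sup>2 / 2 * sinh (\<psi> s)) (at s within {0..?T})"
      if "s \<in> {0..?T}" for s
      using \<gamma>(2)[OF that] unfolding \<gamma>_eq extremal_field_def prod.case has_vector_derivative_Pair_iff
      by (auto simp: has_real_derivative_iff_has_vector_derivative)
    have init: "\<psi> 0 = \<psi>0" "k 0 = c" "x 0 = 0" "y 0 = 0" "z 0 = 0"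
      using \<gamma>(1) by (auto simp: \<gamma>_eq q0_def)
    have k: "k s = c" if "s \<in> {0..?T}" for s
      by (rule eq_if_same_derivative[OF der(2) _ _ that]) (auto simp: init)
    have sinh: "sinh (\<psi> s) = momentum a c (x s)" if s: "s \<in> {0..?T}" for s
    proof (rule eq_if_same_derivative[OF _ _ _ s])
      fix r assume r: "r \<in> {0..?T}"
      show "((\<lambda>r. sinh (\<psi> r)) has_real_derivative cosh (\<psi> r) * (c * x r)) (at r within {0..?T})"
        using der(1)[OF r] k[OF r] by (auto intro!: derivative_eq_intros)
      show "((\<lambda>r. momentum a c (x r))
          has_real_derivative cosh (\<psi> r) * (c * x r)) (at r within {0..?T})"
        unfolding momentum_def using der(3)[OF r] by (auto intro!: derivative_eq_intros)
    qed (simp add: init momentum_def assms(2))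
    have cosh: "cosh (\<psi> s) = hamiltonian 1 a c (x s)" if "s \<in> {0..?T}" for s
      using sinh[OF that] arsinh_sinh_real[of "\<psi> s"] cosh_arsinh_real[of "sinh (\<psi> s)"]
      by (simp add: hamiltonian_def add.commute)
    have "normal_time a c (x s) = s" if s: "s \<in> {0..?T}" for s
    proof (rule eq_if_same_derivative[OF _ _ _ s])
      fix r assume r: "r \<in> {0..?T}"
      show "((\<lambda>r. normal_time a c (x r)) has_real_derivative 1) (at r within {0..?T})"
        using DERIV_chain2[OF DERIV_normal_time[of a c] der(3)[OF r]] cosh[OF r] by simp
    qed (auto simp: init)
    from this[of ?T] T have xT: "x ?T = X" by simp
    have "y ?T = normal_y a c (x ?T)"
    proof (rule eq_if_same_derivative[OF der(4)])
      fix r assume r: "r \<in> {0..?T}"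
      show "((\<lambda>r. normal_y a c (x r)) has_real_derivative sinh (\<psi> r)) (at r within {0..?T})"
        using DERIV_chain2[OF DERIV_normal_y[of a c] der(3)[OF r]] sinh[OF r] cosh[OF r] by simp
    qed (use T in \<open>auto simp: init\<close>)
    moreover have "z ?T = normal_z a c (x ?T)"
    proof (rule eq_if_same_derivative[OF der(5)])
      fix r assume r: "r \<in> {0..?T}"
      show "((\<lambda>r. normal_z a c (x r))
          has_real_derivative (x r)\<^sup>2 / 2 * sinh (\<psi> r)) (at r within {0..?T})"
        using DERIV_chain2[OF DERIV_normal_z[of a c] der(3)[OF r]] sinh[OF r] cosh[OF r] by simp
    qed (use T in \<open>auto simp: init\<close>)
    moreover have "\<psi> ?T = arsinh (momentum a c X)"
      using sinh[of ?T] T xT arsinh_sinh_real by (metis atLeastAtMost_iff order_refl)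
    ultimately show "\<gamma> ?T = \<Gamma> ?T"
      using xT k[of ?T] T by (simp add: \<gamma>_eq \<Gamma>_def)
  qed
  then show ?thesis by (simp add: Exp_def \<Gamma>_def)
qed

text \<open>The control of a normal extremal is \<open>(cosh \<psi>, sinh \<psi>)\<close>, written as
  \<open>(hamiltonian 1 a c x, momentum a c x)\<close>.\<close>
locale normal_extremal =
  fixes \<psi>0 a c X :: real
  assumes a: "a = sinh \<psi>0" and X: "0 \<le> X"
begin

abbreviation "T \<equiv> normal_time a c X"
abbreviation "q \<equiv> \<lambda>t. Exp ((\<psi>0, c), t)"
abbreviation "u \<equiv> \<lambda>t. (hamiltonian 1 a c (normal_x a c t), momentum a c (normal_x a c t))"

lemma T: "0 \<le> T" using X by simp

lemma q_graph:
  assumes "t \<in> {0..T}"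
  shows "q t = (normal_x a c t, normal_y a c (normal_x a c t), normal_z a c (normal_x a c t))"
  using Exp_eq[OF DERIV_normal_x(3) a, of t a c X c] DERIV_normal_x(2)[of t a c X] assms by auto

lemma continuous_on_normal_x: "continuous_on {0..T} (normal_x a c)"
  by (rule DERIV_continuous_on) (rule has_field_derivative_at_within[OF DERIV_normal_x(1)], auto)

sublocale trajectory T q u
proof unfold_locales
  have "q 0 = (normal_x a c 0, normal_y a c (normal_x a c 0), normal_z a c (normal_x a c 0))"
    using q_graph[of 0] X by simp
  moreover have "normal_x a c 0 = 0" using normal_x_normal_time[of a c 0] by simp
  ultimately show "q 0 = q0" by (simp add: q0_def)
  have range: "normal_x a c ` {0..T} \<subseteq> {0..X}" using DERIV_normal_x(3,4) by auto
  obtain L where L: "L-lipschitz_on {0..T} (normal_x a c)"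
    by (rule lipschitz_on_Icc_if_DERIV[OF has_field_derivative_at_within[OF DERIV_normal_x(1)]])
      (auto intro!: continuous_intros continuous_on_normal_x)
  obtain K1 where "K1-lipschitz_on {0..X} (normal_y a c)"
    unfolding normal_y_def by (rule lipschitz_on_primitive[OF continuous_on_normal_slope(2)])
  note Ky = lipschitz_on_compose2[OF L lipschitz_on_subset[OF this range]]
  obtain K2 where "K2-lipschitz_on {0..X} (normal_z a c)"
    unfolding normal_z_def by (rule lipschitz_on_primitive[OF continuous_on_normal_slope(3)])
  note Kz = lipschitz_on_compose2[OF L lipschitz_on_subset[OF this range]]
  have "\<exists>L. L-lipschitz_on {0..T} q"
    using lipschitz_on_transform[OF lipschitz_on_Pair[OF L lipschitz_on_Pair[OF Ky Kz]], of q]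
        q_graph
    by metis
  moreover have "corresponds_to_control T q u"
    unfolding corresponds_to_control_def
  proof (intro conjI ballI AE_I2)
    show "u \<in> borel_measurable (lebesgue_on {0..T})"
      by (intro continuous_imp_measurable_on_sets_lebesgue continuous_intros
          continuous_on_normal_x) auto
    show "u t \<in> U2" for t
      using hamiltonian_1(4) by (simp add: U2_def)
    fix t assume "t \<in> space (lebesgue_on {0..T})"
    then have t: "t \<in> {0..T}" by simp
    let ?x = "normal_x a c t"
    have dx: "(normal_x a c has_real_derivative hamiltonian 1 a c ?x) (at t)"
      by (rule DERIV_normal_x) (use t in auto)
    have dy: "((\<lambda>s. normal_y a c (normal_x a c s)) has_real_derivative momentum a c ?x) (at t)"
      using DERIV_chain2[OF DERIV_normal_y[of a c] dx] by simp
    have dz: "((\<lambda>s. normal_z a c (normal_x a c s))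
        has_real_derivative ?x\<^sup>2 / 2 * momentum a c ?x) (at t)"
      using DERIV_chain2[OF DERIV_normal_z[of a c] dx] by simp
    have "((\<lambda>t. (normal_x a c t, normal_y a c (normal_x a c t), normal_z a c (normal_x a c t)))
        has_vector_derivative
        (hamiltonian 1 a c ?x, momentum a c ?x, ?x\<^sup>2 / 2 * momentum a c ?x)) (at t)"
      using dx dy dz unfolding has_vector_derivative_Pair_iff
      by (simp only: has_real_derivative_iff_has_vector_derivative)
    then have "((\<lambda>t. (normal_x a c t, normal_y a c (normal_x a c t), normal_z a c (normal_x a c
        t))) has_vector_derivative
        (hamiltonian 1 a c ?x, momentum a c ?x, ?x\<^sup>2 / 2 * momentum a c ?x)) (at t within {0..T})"
      by (rule has_vector_derivative_at_within)
    then have "(q has_vector_derivative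
        (hamiltonian 1 a c ?x, momentum a c ?x, ?x\<^sup>2 / 2 * momentum a c ?x)) (at t within {0..T})"
      by (rule has_vector_derivative_transform[OF t, rotated]) (rule q_graph)
    then show "(q has_vector_derivative fst (u t) *\<^sub>R X1 (q t) + snd (u t) *\<^sub>R X2 (q t))
        (at t within {0..T})"
      by (simp add: q_graph[OF t] X1_def X2_def mult.commute)
  qed
  ultimately show "admissible T q u"
    using T by (simp add: admissible_def)
qed

lemma endpoint: "q T = (X, normal_y a c X, normal_z a c X)"
  by (rule Exp_eq[OF X a])

lemma slength_eq: "slength T u = T"
  using X by (simp add: slength_def hamiltonian_1(3) measure_restrict_space)

text \<open>Equality in \<open>length_le\<close> with \<open>\<epsilon> = 1\<close> for the normal extremal, whose length is \<open>T\<close>.\<close>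
lemma primitive_hamiltonian: "primitive (hamiltonian 1 a c) X =
    T + a * normal_y a c X + c * normal_z a c X"
proof (rule primitive_eqI)
  fix s
  have "(1 + (momentum a c s)\<^sup>2) / hamiltonian 1 a c s = hamiltonian 1 a c s"
    unfolding hamiltonian_1(3)[symmetric] by (simp add: power2_eq_square)
  moreover have "1 / hamiltonian 1 a c s + a * slope a c s
      + c * (s\<^sup>2 / 2 * slope a c s) =
      (1 + momentum a c s * (a + c * s\<^sup>2 / 2)) / hamiltonian 1 a c s"
    by (simp add: add_divide_distrib algebra_simps)
  ultimately have "hamiltonian 1 a c s = 1 / hamiltonian 1 a c s + a * slope a c s
      + c * (s\<^sup>2 / 2 * slope a c s)"
    unfolding momentum_def[symmetric] by (simp only: power2_eq_square)
  then show "((\<lambda>s. normal_time a c s + a * normal_y a c s + c * normal_z a c s) has_real_derivative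
      hamiltonian 1 a c s) (at s)"
    by (elim ssubst) (intro DERIV_add DERIV_cmult DERIV_normal)
qed (auto intro: continuous_intros)

text \<open>The bound in \<open>length_le\<close> depends on the endpoint only, and the normal extremal attains
  it.\<close>
lemma competitor:
  assumes "trajectory T' p v" "p T' = q T"
  shows "slength T' v \<le> T" "slength T' v = T \<Longrightarrow> reparametrization_of T q T' p"
proof -
  interpret p: trajectory T' p v by fact
  have end_p: "p.x T' = X" "p.y T' = normal_y a c X" "p.z T' = normal_z a c X"
    using assms(2) endpoint by (simp_all add: p.q_eq)
  show "slength T' v \<le> T"
    using p.length_le[of 1 a c] primitive_hamiltonian end_p by simp
  assume "slength T' v = T"
  then have fb: "AE t in lebesgue_on {0..T'}. p.x t \<noteq> 0 \<longrightarrow>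
      p.u2 t = slope a c (p.x t) * p.u1 t"
    using primitive_hamiltonian end_p by (intro p.length_eq_imp_feedback) auto
  obtain K1 where K1: "K1-lipschitz_on {0..X} (normal_y a c)"
    unfolding normal_y_def by (rule lipschitz_on_primitive[OF continuous_on_normal_slope(2)])
  obtain K2 where K2: "K2-lipschitz_on {0..X} (normal_z a c)"
    unfolding normal_z_def by (rule lipschitz_on_primitive[OF continuous_on_normal_slope(3)])
  have "p t = q (normal_time a c (p.x t))" if "t \<in> {0..T'}" for t
  proof -
    have "p t = (p.x t, normal_y a c (p.x t), normal_z a c (p.x t))"
      by (rule p.graph_of_feedback[OF fb _ _ DERIV_normal_y DERIV_normal_z])
        (use K1 K2 end_p that in auto)
    then show ?thesis
      using p.x_range[OF that] Exp_eq[OF _ a, of "p.x t" c] by simp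
  qed
  from p.reparametrization_of_graph[of q "normal_time a c",
      OF this] show "reparametrization_of T q T' p"
    by (simp add: end_p continuous_on_normal_time mono_on_def)
qed

lemma unique_optimal: "unique_optimal (X, normal_y a c X, normal_z a c X) T q"
  unfolding unique_optimal_def
proof (intro conjI allI impI)
  show "optimal T q"
    unfolding optimal_def
  proof (intro exI[of _ u] conjI allI impI)
    show "admissible T q u" by (rule adm)
    fix T' p v assume "admissible T' p v \<and> p 0 = q 0 \<and> p T' = q T"
    then have "trajectory T' p v" "p T' = q T"
      using start by (auto intro: trajectory.intro)
    from competitor(1)[OF this] show "slength T' v \<le> slength T u"
      by (simp only: slength_eq)
  qed
  show "q 0 = q0" by (rule start)
  show "q T = (X, normal_y a c X, normal_z a c X)" by (rule endpoint)
  fix T' p assume p: "optimal T' p \<and> p 0 = q0 \<and> p T' = (X, normal_y a c X, normal_z a c X)"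
  then obtain v where v: "admissible T' p v"
    and best: "\<And>T q u. admissible T q u \<and> q 0 = p 0 \<and> q T = p T' \<longrightarrow> slength T u \<le> slength T' v"
    unfolding optimal_def by blast
  have "trajectory T' p v" "p T' = q T"
    using p v endpoint by (auto simp: trajectory_def)
  note competitor[OF this]
  moreover have "slength T u \<le> slength T' v"
    using best[of T q u] adm start p endpoint by simp
  ultimately show "reparametrization_of T q T' p"
    unfolding slength_eq by simp
qed

end

section \<open>The domain of the exponential mapping\<close>

definition elliptic_integrand :: "real \<Rightarrow> real \<Rightarrow> real" where
  "elliptic_integrand k \<theta> = 1 / sqrt (1 - k\<^sup>2 * (sin \<theta>)\<^sup>2)"

context
  fixes k :: real
  assumes k: "k\<^sup>2 < 1"
begin

lemma elliptic_radicand_pos: "0 < 1 - k\<^sup>2 * (sin \<theta>)\<^sup>2"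
proof -
  have "k\<^sup>2 * (sin \<theta>)\<^sup>2 \<le> k\<^sup>2 * 1"
    by (intro mult_left_mono) (auto simp: abs_square_le_1)
  then show ?thesis using k by simp
qed

lemma continuous_on_elliptic_integrand: "continuous_on S (elliptic_integrand k)"
proof -
  have "sqrt (1 - k\<^sup>2 * (sin \<theta>)\<^sup>2) \<noteq> 0" for \<theta>
    using elliptic_radicand_pos[of \<theta>] by auto
  then show ?thesis
    unfolding elliptic_integrand_def by (intro continuous_intros) auto
qed

lemma elliptic_integrand_pos: "0 < elliptic_integrand k \<theta>"
  using elliptic_radicand_pos by (simp add: elliptic_integrand_def)

text \<open>The integrand is symmetric about \<open>pi / 2\<close>.\<close>
lemma primitive_elliptic_pi: "primitive (elliptic_integrand k) pi = 2 * elliptic_K k"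
proof -
  let ?f = "elliptic_integrand k"
  note P = DERIV_primitive[OF continuous_on_elliptic_integrand]
  have "primitive ?f (pi / 2) = primitive ?f pi - primitive ?f (pi - pi / 2)"
  proof (rule primitive_eqI[OF _ continuous_on_elliptic_integrand])
    fix \<theta> :: real
    have "?f (pi - \<theta>) = ?f \<theta>" by (simp add: elliptic_integrand_def)
    then show "((\<lambda>\<theta>. primitive ?f pi - primitive ?f (pi - \<theta>)) has_real_derivative ?f \<theta>) (at \<theta>)"
      by (auto intro!: derivative_eq_intros DERIV_chain2[OF P])
  qed simp
  moreover have "primitive ?f (pi / 2) = elliptic_K k"
    by (simp add: primitive_eq_integral elliptic_K_def elliptic_integrand_def[abs_def])
  ultimately show ?thesis by simp
qed

end

lemma modulus_sq:
  assumes "a = sinh \<psi>0" "c \<noteq> 0"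
  shows "(modulus \<psi>0 c)\<^sup>2 = (1 - sgn c * a / sqrt (1 + a\<^sup>2)) / 2" "(modulus \<psi>0 c)\<^sup>2 < 1"
proof -
  let ?r = "sgn c * a / sqrt (1 + a\<^sup>2)"
  have "\<bar>a\<bar> < sqrt (1 + a\<^sup>2)"
    by (metis real_sqrt_abs real_sqrt_less_iff less_add_same_cancel2 zero_less_one)
  then have "\<bar>?r\<bar> < 1"
    using assms(2) by (simp add: abs_mult abs_sgn_eq divide_less_eq add_pos_nonneg)
  then have r: "- 1 < ?r" "?r < 1" by linarith+
  have "modulus \<psi>0 c = sqrt ((1 - ?r) / 2)"
    by (simp add: modulus_def E0_def assms(1))
  then show "(modulus \<psi>0 c)\<^sup>2 = (1 - ?r) / 2" using r by simp
  then show "(modulus \<psi>0 c)\<^sup>2 < 1" using r by simp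
qed

text \<open>The time integrand is \<open>1\<close> over the square root of the quartic \<open>1 + (a + c s\<^sup>2 / 2)\<^sup>2\<close>.
  The substitution \<open>s = s0 tan (\<theta> / 2)\<close>, with \<open>s0\<close> such that the coefficients of \<open>sin\<^sup>4\<close> and
  \<open>cos\<^sup>4\<close> agree, is the classical one that brings an even quartic of this kind to Legendre
  form.\<close>
lemma normal_time_elliptic:
  fixes c :: real
  assumes a: "a = sinh \<psi>0" and c: "c \<noteq> 0" and \<theta>: "0 \<le> \<theta>" "\<theta> < pi"
  defines "R \<equiv> sqrt (1 + a\<^sup>2)"
  defines "s0 \<equiv> sqrt (2 * R / \<bar>c\<bar>)"
  shows "normal_time a c (s0 * tan (\<theta> / 2)) =
      s0 / (2 * R) * primitive (elliptic_integrand (modulus \<psi>0 c)) \<theta>"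
proof -
  let ?k = "modulus \<psi>0 c"
  note k = modulus_sq[OF a c]
  have R: "0 < R" "R\<^sup>2 = 1 + a\<^sup>2" "1 \<le> R" by (simp_all add: R_def add_pos_nonneg)
  have s0: "0 < s0" "s0\<^sup>2 = 2 * R / \<bar>c\<bar>" using R c by (simp_all add: s0_def)
  have "normal_time a c (s0 * tan (\<theta> / 2)) = s0 / (2 * R) * primitive (elliptic_integrand ?k) \<theta>"
  proof (rule eq_if_same_derivative[where f = "\<lambda>r. normal_time a c (s0 * tan (r / 2))"
        and g = "\<lambda>r. s0 / (2 * R) * primitive (elliptic_integrand ?k) r"])
    fix r assume r: "r \<in> {0..\<theta>}"
    then have cos: "0 < cos (r / 2)" using \<theta> by (intro cos_gt_zero_pi) auto
    define C S where "C = (cos (r / 2))\<^sup>2" and "S = (sin (r / 2))\<^sup>2"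
    have CS: "C + S = 1" and C0: "0 < C" using cos by (simp_all add: C_def S_def)
    have sin2: "(sin r)\<^sup>2 = 4 * S * C"
      using sin_double[of "r / 2"] by (simp add: C_def S_def power_mult_distrib)
    let ?X = "s0 * tan (r / 2)"
    have X2: "?X\<^sup>2 = 2 * R / \<bar>c\<bar> * (S / C)"
      by (simp add: power_mult_distrib s0 tan_def power_divide C_def S_def)
    have "c / \<bar>c\<bar> = sgn c" by (simp add: sgn_if)
    have m: "momentum a c ?X = a + sgn c * R * S / C"
    proof -
      have "momentum a c ?X = a + (c / \<bar>c\<bar>) * R * S / C"
        unfolding momentum_def X2 by simp
      then show ?thesis by (simp only: \<open>c / \<bar>c\<bar> = sgn c\<close>)
    qed
    have "(hamiltonian 1 a c ?X * C)\<^sup>2 = C\<^sup>2 + (a * C + sgn c * R * S)\<^sup>2"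
      unfolding power_mult_distrib hamiltonian_1(3) m using C0
      by (simp add: power2_eq_square field_simps)
    also have "\<dots> = R\<^sup>2 * (1 - ?k\<^sup>2 * (sin r)\<^sup>2)"
    proof -
      have sg: "(sgn c)\<^sup>2 = 1" using c by (simp add: sgn_if)
      have "C\<^sup>2 + (a * C + sgn c * R * S)\<^sup>2 =
          C\<^sup>2 * R\<^sup>2 + 2 * a * sgn c * R * S * C + (sgn c)\<^sup>2 * R\<^sup>2 * S\<^sup>2"
        using R(2) by algebra
      also have "\<dots> = R\<^sup>2 * ((C + S)\<^sup>2 - 2 * S * C) + 2 * a * sgn c * R * S * C"
        unfolding sg by algebra
      also have "\<dots> = R\<^sup>2 - 2 * S * C * (R\<^sup>2 - sgn c * a * R)"
        unfolding CS by (simp add: algebra_simps)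
      also have "R\<^sup>2 - sgn c * a * R = R\<^sup>2 * (1 - sgn c * a / R)"
        using R(1) by (simp add: power2_eq_square field_simps)
      also have "1 - sgn c * a / R = 2 * ?k\<^sup>2"
        unfolding k(1) R_def by simp
      finally show ?thesis unfolding sin2 by algebra
    qed
    finally have "hamiltonian 1 a c ?X * C = sqrt (R\<^sup>2 * (1 - ?k\<^sup>2 * (sin r)\<^sup>2))"
      using C0 hamiltonian_1(2)[of a c ?X] by (metis real_sqrt_unique mult_pos_pos less_imp_le)
    then have hC: "hamiltonian 1 a c ?X * C = R * sqrt (1 - ?k\<^sup>2 * (sin r)\<^sup>2)"
      using R(1) by (simp only: real_sqrt_mult real_sqrt_abs abs_of_pos)
    have "((\<lambda>r. s0 * tan (r / 2)) has_real_derivative s0 * (inverse C * (1 / 2))) (at r)"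
      using cos by (auto intro!: derivative_eq_intros simp: C_def)
    from DERIV_chain2[OF DERIV_normal_time[of a c] this]
    have "((\<lambda>r. normal_time a c (s0 * tan (r / 2))) has_real_derivative
        s0 / (2 * (hamiltonian 1 a c ?X * C))) (at r)"
      using C0 by (simp add: field_simps)
    also have "s0 / (2 * (hamiltonian 1 a c ?X * C)) = s0 / (2 * R) * elliptic_integrand ?k r"
      unfolding hC by (simp add: elliptic_integrand_def)
    finally show "((\<lambda>r. normal_time a c (s0 * tan (r / 2))) has_real_derivative
        s0 / (2 * R) * elliptic_integrand ?k r) (at r within {0..\<theta>})"
      by (rule has_field_derivative_at_within)
    show "((\<lambda>r. s0 / (2 * R) * primitive (elliptic_integrand ?k) r) has_real_derivative
        s0 / (2 * R) * elliptic_integrand ?k r) (at r within {0..\<theta>})"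
      by (rule has_field_derivative_at_within[OF DERIV_cmult[OF DERIV_primitive[OF
          continuous_on_elliptic_integrand[OF k(2)]]]])
  qed (use \<theta> in auto)
  then show ?thesis .
qed

text \<open>For \<open>c \<noteq> 0\<close> the half angle \<open>\<theta> / 2\<close> runs from \<open>0\<close> to \<open>pi / 2\<close> as \<open>X\<close> runs from \<open>0\<close> to
  infinity, so the supremum of the times is the value of the elliptic integral at \<open>\<theta> = pi\<close>.
  For \<open>c = 0\<close> the time is a linear function of \<open>X\<close>.\<close>
lemma N_iff:
  assumes a: "a = sinh \<psi>0"
  shows "((\<psi>0, c), t) \<in> N \<longleftrightarrow> (\<exists>X>0. t = normal_time a c X)"
proof (cases "c = 0")
  case True
  have R: "0 < sqrt (1 + a\<^sup>2)" by (simp add: add_pos_nonneg)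
  have "((\<lambda>s. s / sqrt (1 + a\<^sup>2)) has_real_derivative 1 / sqrt (1 + a\<^sup>2)) (at s)" for s
    by (rule DERIV_cdivide) (rule DERIV_ident)
  then have normal_time: "normal_time a 0 X = X / sqrt (1 + a\<^sup>2)" for X
    unfolding normal_time_def by (intro primitive_eqI) (auto simp: hamiltonian_def momentum_def)
  have "(\<exists>X>0. t = normal_time a c X) \<longleftrightarrow> 0 < t"
  proof
    assume "0 < t"
    then show "\<exists>X>0. t = normal_time a c X"
      using R by (intro exI[of _ "t * sqrt (1 + a\<^sup>2)"]) (simp add: True normal_time)
  qed auto
  then show ?thesis by (simp add: N_def True)
next
  case False
  let ?k = "modulus \<psi>0 c"
  let ?P = "primitive (elliptic_integrand ?k)"
  note k = modulus_sq(2)[OF a False]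
  define R where "R = sqrt (1 + a\<^sup>2)"
  define s0 where "s0 = sqrt (2 * R / \<bar>c\<bar>)"
  have R: "0 < R" by (simp add: R_def add_pos_nonneg)
  have s0: "0 < s0" using R False by (simp add: s0_def)
  have normal_time: "normal_time a c (s0 * tan (\<theta> / 2)) = s0 / (2 * R) * ?P \<theta>" if "0 \<le> \<theta>" "\<theta> < pi"
      for \<theta>
    using normal_time_elliptic[OF a False that] unfolding s0_def R_def .
  have T: "elliptic_K ?k / (sqrt \<bar>c\<bar> * ae \<psi>0) = s0 / (2 * R) * ?P pi"
  proof -
    have "ae \<psi>0 = sqrt (R / 2)" by (simp add: ae_def E0_def a R_def)
    moreover have "s0 * (sqrt \<bar>c\<bar> * sqrt (R / 2)) = R"
    proof -
      have "s0 * (sqrt \<bar>c\<bar> * sqrt (R / 2)) = sqrt (2 * R / \<bar>c\<bar> * (\<bar>c\<bar> * (R / 2)))"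
        by (simp only: s0_def real_sqrt_mult)
      also have "2 * R / \<bar>c\<bar> * (\<bar>c\<bar> * (R / 2)) = R\<^sup>2"
        using False by (simp add: power2_eq_square)
      finally show ?thesis using R by simp
    qed
    ultimately have *: "s0 * (sqrt \<bar>c\<bar> * ae \<psi>0) = R" by simp
    then have "sqrt \<bar>c\<bar> * ae \<psi>0 \<noteq> 0" using R by auto
    then show ?thesis
      unfolding primitive_elliptic_pi[OF k] *[symmetric] using s0 by (simp add: field_simps)
  qed
  have "(\<exists>X>0. t = normal_time a c X) \<longleftrightarrow> 0 < t \<and> t < s0 / (2 * R) * ?P pi"
  proof (intro iffI conjI)
    assume "\<exists>X>0. t = normal_time a c X"
    then obtain X where X: "0 < X" "t = normal_time a c X" by blast
    then show "0 < t" by simp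
    define \<theta> where "\<theta> = 2 * arctan (X / s0)"
    have \<theta>: "0 \<le> \<theta>" "\<theta> < pi"
      using X s0 arctan_ubound[of "X / s0"] by (auto simp: \<theta>_def)
    have "s0 * tan (\<theta> / 2) = X" using s0 by (simp add: \<theta>_def tan_arctan)
    then have "t = s0 / (2 * R) * ?P \<theta>" using normal_time[OF \<theta>] X by simp
    also have "\<dots> < s0 / (2 * R) * ?P pi"
      using s0 R by (intro mult_strict_left_mono primitive_strict_mono \<theta>(2) k
          continuous_on_elliptic_integrand elliptic_integrand_pos) auto
    finally show "t < s0 / (2 * R) * ?P pi" .
  next
    assume t: "0 < t \<and> t < s0 / (2 * R) * ?P pi"
    have "continuous_on {0..pi} ?P"
      by (rule DERIV_continuous_on) (rule has_field_derivative_at_within[OF DERIV_primitive[OF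
          continuous_on_elliptic_integrand[OF k]]])
    then have "continuous_on {0..pi} (\<lambda>\<theta>. s0 / (2 * R) * ?P \<theta>)"
      by (rule continuous_on_mult_left)
    then obtain \<theta> where \<theta>: "0 \<le> \<theta>" "\<theta> \<le> pi" "s0 / (2 * R) * ?P \<theta> = t"
      using IVT'[of "\<lambda>\<theta>. s0 / (2 * R) * ?P \<theta>" 0 t pi] t by auto
    then have "0 < \<theta>" "\<theta> < pi"
      using t by (auto simp: less_le)
    then show "\<exists>X>0. t = normal_time a c X"
      using normal_time[of \<theta>] \<theta> s0
      by (intro exI[of _ "s0 * tan (\<theta> / 2)"]) (auto intro!: mult_pos_pos tan_gt_zero)
  qed
  then show ?thesis
    by (simp add: N_def False T)
qed

section \<open>Endpoints of normal extremals\<close>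

lemma normal_slope_eq_tanh: "slope a c s = tanh (arsinh (momentum a c s))"
  by (simp add: tanh_def cosh_arsinh_real hamiltonian_def add.commute)

lemma arsinh_real_iff [simp]:
  fixes p r :: real
  shows "arsinh p \<le> arsinh r \<longleftrightarrow> p \<le> r" "arsinh p = arsinh r \<longleftrightarrow> p = r"
  by (metis arsinh_less_iff_real linorder_not_le, metis sinh_arsinh_real)

definition A2_open_hull :: "point set" where
  "A2_open_hull = {(x, y, z). \<bar>y\<bar> < x \<and> zb1 x y < z \<and> z < zb2 x y}"

lemma momentum_diff_slope_diff_nonneg:
  "0 \<le> (momentum a c s - momentum a' c' s) * (slope a c s - slope a' c' s)"
  unfolding normal_slope_eq_tanh
  by (rule split_mult_pos_le) auto

text \<open>The derivative of \<open>sqrt (1 + p\<^sup>2)\<close> is strictly increasing in \<open>p\<close>. So if two momenta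
  had the same endpoint, the nonnegative continuous function \<open>?D\<close> would have integral \<open>0\<close>,
  whence the momenta agree on \<open>{0..X}\<close>.\<close>
lemma normal_endpoint_inj:
  assumes X: "0 < X" and eq: "normal_y a c X = normal_y a' c' X" "normal_z a c X = normal_z a' c' X"
  shows "a = a' \<and> c = c'"
proof -
  let ?D = "\<lambda>s. (momentum a c s - momentum a' c' s) * (slope a c s - slope a' c' s)"
  have cont: "continuous_on S ?D" for S
    by (intro continuous_intros) auto
  have "primitive ?D X =
      (a - a') * (normal_y a c X - normal_y a' c' X)
          + (c - c') * (normal_z a c X - normal_z a' c' X)"
  proof (rule primitive_eqI[OF _ cont])
    fix s
    have "?D s = (a - a') * (slope a c s - slope a' c' s)
      + (c - c') * (s\<^sup>2 / 2 * slope a c s - s\<^sup>2 / 2 * slope a' c' s)"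
    proof -
      have "momentum a c s - momentum a' c' s = (a - a') + (c - c') * (s\<^sup>2 / 2)"
        by (simp add: momentum_def algebra_simps diff_divide_distrib)
      then show ?thesis by (simp only:) (simp only: algebra_simps)
    qed
    then show "((\<lambda>X. (a - a') * (normal_y a c X - normal_y a' c' X)
        + (c - c') * (normal_z a c X - normal_z a' c' X))
        has_real_derivative ?D s) (at s)"
      by (elim ssubst) (intro DERIV_add DERIV_cmult DERIV_diff DERIV_normal)
  qed simp
  then have "integral {0..X} ?D = 0"
    using X eq by (simp add: primitive_eq_integral)
  then have D0: "?D s = 0" if "s \<in> {0..X}" for s
    using integral_eq_0_iff[OF cont X momentum_diff_slope_diff_nonneg] that by blast
  have momentum: "momentum a c s = momentum a' c' s" if s: "s \<in> {0..X}" for s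
    using D0[OF s] unfolding normal_slope_eq_tanh by auto
  from momentum[of 0] momentum[of X] X show ?thesis by (simp add: momentum_def)
qed

text \<open>In the open region the bound \<open>length_le\<close> with \<open>\<epsilon> = 0\<close> is strict for every nonzero
  covector. For \<open>c \<noteq> 0\<close> the upper or the lower boundary point with the same \<open>X\<close> and \<open>Y\<close>,
  according to the sign of \<open>c\<close>, satisfies the weak bound and lies strictly further in the
  direction \<open>(a, c)\<close>; for \<open>c = 0\<close> the bound is \<open>\<bar>Y\<bar> < X\<close>.\<close>
lemma support_less:
  assumes B: "(X, Y, Z) \<in> A2_open_hull" and nonzero: "(a, c) \<noteq> (0, 0)"
  shows "a * Y + c * Z < primitive (hamiltonian 0 a c) X"
proof -
  have Y: "\<bar>Y\<bar> < X" "zb1 X Y < Z" "Z < zb2 X Y" using B by (auto simp: A2_open_hull_def)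
  then have Y': "\<bar>Y\<bar> \<le> X" by simp
  interpret l: bang_bang 1 "(X + Y) / 2" X "\<lambda>t. (t, bang_y 1 ((X + Y) / 2) t, bang_z 1 ((X
      + Y) / 2) t)"
    by (rule lower_bang[OF Y'])
  interpret u: bang_bang "-1"
      "(X - Y) / 2" X "\<lambda>t. (t, bang_y (-1) ((X - Y) / 2) t, bang_z (-1) ((X - Y) / 2) t)"
    by (rule upper_bang[OF Y'])
  have le: "a * Y + c * zb1 X Y \<le> primitive (hamiltonian 0 a c) X"
      "a * Y + c * zb2 X Y \<le> primitive (hamiltonian 0 a c) X"
    using l.length_le[of 0 a c] u.length_le[of 0 a c] l.coordinates[of X] u.coordinates[of X]
      lower_bang(2,3)[OF Y'] upper_bang(2,3)[OF Y'] Y' by auto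
  consider "c < 0" | "c = 0" | "0 < c" by linarith
  then show ?thesis
  proof cases
    case 1
    then have "c * Z < c * zb1 X Y" using Y by simp
    then show ?thesis using le by linarith
  next
    case 2
    then have "a \<noteq> 0" using nonzero by simp
    have "a * Y \<le> \<bar>a\<bar> * \<bar>Y\<bar>" by (metis abs_ge_self abs_mult)
    also have "\<dots> < \<bar>a\<bar> * X" using Y \<open>a \<noteq> 0\<close> by simp
    also have "\<dots> = primitive (hamiltonian 0 a c) X"
      using 2 by (intro primitive_eqI[symmetric])
          (auto simp: hamiltonian_def momentum_def intro!: derivative_eq_intros)
    finally show ?thesis using 2 by simp
  next
    case 3
    then have "c * Z < c * zb2 X Y" using Y by simp
    then show ?thesis using le by linarith
  qed
qed

lemma primitive_hamiltonian_homogeneous: "0 \<le> r \<Longrightarrow>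
    primitive (hamiltonian 0 (r * a) (r * c)) X = r * primitive (hamiltonian 0 a c) X"
proof (rule primitive_eqI)
  assume r: "0 \<le> r"
  fix s
  have "momentum (r * a) (r * c) s = r * momentum a c s" by (simp add: momentum_def algebra_simps)
  then have "hamiltonian 0 (r * a) (r * c) s = r * hamiltonian 0 a c s"
    using r by (simp add: hamiltonian_def abs_mult)
  then show "((\<lambda>X. r * primitive (hamiltonian 0 a c) X)
      has_real_derivative hamiltonian 0 (r * a) (r * c) s) (at s)"
    by (elim ssubst) (intro DERIV_cmult DERIV_primitive continuous_intros)
qed (auto intro: continuous_intros)

lemma continuous_on_primitive_hamiltonian:
  assumes "0 \<le> X"
  shows "continuous_on S (\<lambda>(a, c). primitive (hamiltonian \<epsilon> a c) X)"
proof -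
  have "continuous_on S (\<lambda>p. integral (cbox 0 X) (hamiltonian \<epsilon> (fst p) (snd p)))"
    by (rule integral_continuous_on_param)
      (unfold hamiltonian_def momentum_def case_prod_beta, intro continuous_intros; simp)
  then show ?thesis
    using assms by (simp add: case_prod_beta primitive_eq_integral)
qed

text \<open>The function \<open>H\<close> is continuous, positively homogeneous and positive away from \<open>0\<close>, so
  it grows at least linearly. It bounds the dual function \<open>\<Phi>\<close> from below, since
  \<open>hamiltonian 0 \<le> hamiltonian 1\<close>.\<close>
lemma dual_attains_min:
  assumes B: "(X, Y, Z) \<in> A2_open_hull"
  obtains a c where "\<And>a' c'. primitive (hamiltonian 1 a c) X - a * Y - c * Z \<le>
      primitive (hamiltonian 1 a' c') X - a' * Y - c' * Z"
proof -
  have X: "0 < X" using B by (auto simp: A2_open_hull_def)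
  define \<Phi> where "\<Phi> = (\<lambda>(a, c). primitive (hamiltonian 1 a c) X - a * Y - c * Z)"
  define H where "H = (\<lambda>(a, c). primitive (hamiltonian 0 a c) X - a * Y - c * Z)"
  have "continuous_on S (\<lambda>p. (case p of (a, c) \<Rightarrow> primitive (hamiltonian \<epsilon> a c) X) - fst p * Y -
      snd p * Z)" for \<epsilon> S
    by (intro continuous_intros continuous_on_primitive_hamiltonian) (use X in auto)
  then have cont: "continuous_on S \<Phi>" "continuous_on S H" for S
    unfolding \<Phi>_def H_def by (simp_all add: case_prod_beta)
  \<comment> \<open>The minimum of \<open>H\<close> on the unit circle is the rate of growth.\<close>
  have "\<exists>w\<in>sphere 0 1. \<forall>v\<in>sphere 0 1. H w \<le> H v"
    by (rule continuous_attains_inf) (auto simp: cont)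
  then obtain w :: "real \<times> real" where w: "norm w = 1" "\<And>v. norm v = 1 \<Longrightarrow> H w \<le> H v"
    by auto
  have m: "0 < H w"
  proof -
    have "w \<noteq> 0" using w(1) by auto
    then have "(fst w, snd w) \<noteq> (0, 0)" by (metis prod.collapse zero_prod_def)
    from support_less[OF B this] show ?thesis by (simp add: H_def case_prod_beta)
  qed
  have H_ge: "H w * norm v \<le> H v" for v
  proof (cases "v = 0")
    case False
    define v' where "v' = inverse (norm v) *\<^sub>R v"
    have v: "v = norm v *\<^sub>R v'" using False by (simp add: v'_def)
    have "H (r *\<^sub>R v') = r * H v'" if "0 \<le> r" for r
      by (simp add: H_def case_prod_beta primitive_hamiltonian_homogeneous[OF that]
          right_diff_distrib mult.assoc)
    then have "H v = norm v * H v'" by (metis norm_ge_zero v)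
    moreover have "H w \<le> H v'"
      using False by (intro w(2)) (simp add: v'_def)
    ultimately show ?thesis
      using mult_left_mono[OF _ norm_ge_zero, of "H w" "H v'" v] by (simp add: mult.commute)
  next
    case True
    then show ?thesis
        by (simp add: H_def zero_prod_def primitive_hamiltonian_homogeneous[of 0 0 0, simplified])
  qed
  have \<Phi>_ge: "H v \<le> \<Phi> v" for v
  proof -
    have "primitive (hamiltonian 0 a c) X \<le> primitive (hamiltonian 1 a c) X" for a c
    proof (rule primitive_le)
      show "hamiltonian 0 a c s \<le> hamiltonian 1 a c s" for s
        using hamiltonian_1(4)[of a c s] by (simp add: hamiltonian_def)
    qed (use X in \<open>auto intro: continuous_intros\<close>)
    then show ?thesis by (simp add: \<Phi>_def H_def case_prod_beta)
  qed
  \<comment> \<open>The value of \<open>\<Phi>\<close> at \<open>0\<close> is \<open>X\<close>, so \<open>\<Phi>\<close> exceeds it outside the disc of radius \<open>X / H w\<close>.\<close>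
  have "primitive (hamiltonian 1 0 0) X = X"
    by (rule primitive_eqI) (auto simp: hamiltonian_def momentum_def)
  then have \<Phi>0: "\<Phi> 0 = X" by (simp add: \<Phi>_def zero_prod_def)
  have "0 \<le> X / H w" using X m by simp
  then have "\<exists>p\<in>cball 0 (X / H w). \<forall>v\<in>cball 0 (X / H w). \<Phi> p \<le> \<Phi> v"
    by (intro continuous_attains_inf cont) auto
  then obtain p where "\<forall>v\<in>cball 0 (X / H w). \<Phi> p \<le> \<Phi> v" by blast
  then have p: "\<Phi> p \<le> \<Phi> v" if "norm v \<le> X / H w" for v
    using that by simp
  have "\<Phi> p \<le> \<Phi> v" for v
  proof (cases "norm v \<le> X / H w")
    case False
    then have "X < H w * norm v" using m by (simp add: field_simps)
    also have "\<dots> \<le> \<Phi> v" using H_ge \<Phi>_ge order_trans by blast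
    finally show ?thesis using p[of 0] X m \<Phi>0 by simp
  qed (rule p)
  then show ?thesis
    using that[of "fst p" "snd p"] by (force simp: \<Phi>_def case_prod_beta)
qed

text \<open>Quadratic upper bound by the tangent line; the second derivative of \<open>sqrt (1 + p\<^sup>2)\<close>
  is at most \<open>1\<close>. The proof estimates the product of the two roots by the mean of their
  squares.\<close>
lemma sqrt_one_plus_sq_le:
  fixes p \<delta> :: real
  shows "sqrt (1 + (p + \<delta>)\<^sup>2) \<le> sqrt (1 + p\<^sup>2) + \<delta> * (p / sqrt (1 + p\<^sup>2)) + \<delta>\<^sup>2 / 2"
proof -
  define h where "h = sqrt (1 + p\<^sup>2)"
  define h' where "h' = sqrt (1 + (p + \<delta>)\<^sup>2)"
  have h: "1 \<le> h" "h\<^sup>2 = 1 + p\<^sup>2" "h'\<^sup>2 = 1 + (p + \<delta>)\<^sup>2"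
    by (simp_all add: h_def h'_def)
  have "h' * h \<le> (h'\<^sup>2 + h\<^sup>2) / 2"
    using sum_squares_bound[of h' h] by simp
  also have "\<dots> = h\<^sup>2 + \<delta> * p + \<delta>\<^sup>2 / 2"
    unfolding h by (simp add: power2_eq_square algebra_simps add_divide_distrib)
  also have "\<dots> \<le> h\<^sup>2 + \<delta> * p + \<delta>\<^sup>2 / 2 * h"
    using h(1) by (intro add_left_mono) (auto simp: mult_le_cancel_left1)
  also have "\<dots> = (h + \<delta> * (p / h) + \<delta>\<^sup>2 / 2) * h"
    using h(1) by (simp add: power2_eq_square algebra_simps)
  finally have "h' \<le> h + \<delta> * (p / h) + \<delta>\<^sup>2 / 2"
    using h(1) by (meson less_le_trans mult_le_cancel_right_pos zero_less_one)
  then show ?thesis by (simp add: h_def h'_def)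
qed

text \<open>The first-order condition at a minimum, for functions with a quadratic upper bound.\<close>
lemma zero_if_quadratic_nonneg:
  fixes A C :: real
  assumes "\<And>h. 0 \<le> h * A + h\<^sup>2 * C" "0 \<le> C"
  shows "A = 0"
proof (rule ccontr)
  assume "A \<noteq> 0"
  \<comment> \<open>The minimizer of \<open>h * A + h\<^sup>2 * (C + 1)\<close>; the shift by \<open>1\<close> covers \<open>C = 0\<close>.\<close>
  define h where "h = - A / (2 * (C + 1))"
  have "h * A + h\<^sup>2 * C = - (A\<^sup>2) * (C + 2) / (4 * (C + 1)\<^sup>2)"
    using assms(2) unfolding h_def
    by (simp add: power2_eq_square divide_simps) (simp add: algebra_simps)
  also have "\<dots> < 0"
    using \<open>A \<noteq> 0\<close> assms(2) by (intro divide_neg_pos mult_neg_pos) auto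
  finally show False using assms(1)[of h] by simp
qed

text \<open>At a minimizer of the dual function both partial derivatives vanish, and they are
  \<open>normal_y a c X - Y\<close> and \<open>normal_z a c X - Z\<close>. Quadratic upper bounds in the two
  directions replace differentiation under the integral sign.\<close>
lemma normal_endpoint_surj:
  assumes B: "(X, Y, Z) \<in> A2_open_hull"
  obtains a c where "normal_y a c X = Y" "normal_z a c X = Z"
proof -
  have X: "0 \<le> X" using B by (auto simp: A2_open_hull_def)
  obtain a c where min: "\<And>a' c'. primitive (hamiltonian 1 a c) X - a * Y - c * Z \<le>
      primitive (hamiltonian 1 a' c') X - a' * Y - c' * Z"
    using dual_attains_min[OF B] by blast
  have ham_le: "hamiltonian 1 a' c' s \<le> hamiltonian 1 a c s + \<delta> * slope a c s + \<delta>\<^sup>2 / 2"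
    if "momentum a' c' s = momentum a c s + \<delta>" for a' c' s \<delta>
    using sqrt_one_plus_sq_le[of "momentum a c s" \<delta>] that by (simp add: hamiltonian_def)
  have "0 \<le> h * (normal_y a c X - Y) + h\<^sup>2 * (X / 2)" for h
  proof -
    let ?g = "\<lambda>s. hamiltonian 1 a c s + h * slope a c s + h\<^sup>2 / 2"
    have "primitive (hamiltonian 1 (a + h) c) X \<le> primitive ?g X"
      by (intro primitive_le continuous_intros X ham_le) (auto simp: momentum_def)
    also have "primitive ?g X = primitive (hamiltonian 1 a c) X + h * normal_y a c X + h\<^sup>2 / 2 * X"
      by (rule primitive_eqI)
          (auto intro!: derivative_eq_intros DERIV_primitive DERIV_normal continuous_intros)
    finally show ?thesis using min[of "a + h" c] by (simp add: algebra_simps)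
  qed
  then have "normal_y a c X - Y = 0"
    by (rule zero_if_quadratic_nonneg) (use X in auto)
  moreover have "0 \<le> h * (normal_z a c X - Z) + h\<^sup>2 * (X^5 / 40)" for h
  proof -
    let ?g = "\<lambda>s. hamiltonian 1 a c s + h * (s\<^sup>2 / 2 * slope a c s) + h\<^sup>2 * (s^4 / 8)"
    have "primitive (hamiltonian 1 a (c + h)) X \<le> primitive ?g X"
    proof (intro primitive_le continuous_intros X)
      fix s
      show "hamiltonian 1 a (c + h) s \<le> ?g s"
        using ham_le[of a "c + h" s "h * s\<^sup>2 / 2"]
        by (simp add: momentum_def algebra_simps add_divide_distrib power2_eq_square
            eval_nat_numeral)
    qed auto
    also have "primitive ?g X =
        primitive (hamiltonian 1 a c) X + h * normal_z a c X + h\<^sup>2 * (X^5 / 40)"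
      by (rule primitive_eqI)
          (auto intro!: derivative_eq_intros DERIV_primitive DERIV_normal continuous_intros)
    finally show ?thesis using min[of a "c + h"] by (simp add: algebra_simps)
  qed
  then have "normal_z a c X - Z = 0"
    by (rule zero_if_quadratic_nonneg) (use X in auto)
  ultimately show ?thesis using that[of a c] by simp
qed

lemma A2I: "trajectory T q u \<Longrightarrow> q T \<in> A2"
  unfolding A2_def trajectory_def by blast

text \<open>A normal extremal has positive length, whereas every trajectory to a point of the
  surfaces \<open>zb1\<close> and \<open>zb2\<close> has length \<open>0\<close>. For \<open>\<bar>y\<bar> = x\<close> the two surfaces meet.\<close>
lemma normal_endpoint_mem:
  assumes X: "0 < X"
  shows "(X, normal_y a c X, normal_z a c X) \<in> A2 \<inter> A2_open_hull"
proof -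
  let ?y = "normal_y a c X" and ?z = "normal_z a c X"
  interpret n: normal_extremal "arsinh a" a c X
    by unfold_locales (use X in auto)
  note n_traj = n.trajectory_axioms
  have A2: "(X, ?y, ?z) \<in> A2"
    using A2I[OF n_traj] unfolding n.endpoint .
  then have hull: "\<bar>?y\<bar> \<le> X" "zb1 X ?y \<le> ?z" "?z \<le> zb2 X ?y"
    using A2_subset_hull by (auto simp: A2_hull_def)
  have "0 < n.T" using X by simp
  then have len: "slength n.T n.u \<noteq> 0" unfolding n.slength_eq by linarith
  interpret l: bang_bang 1 "(X + ?y) / 2" X "\<lambda>t. (t, bang_y 1 ((X + ?y) / 2) t, bang_z 1 ((X
      + ?y) / 2) t)"
    by (rule lower_bang[OF hull(1)])
  interpret u: bang_bang "-1"
      "(X - ?y) / 2" X "\<lambda>t. (t, bang_y (-1) ((X - ?y) / 2) t, bang_z (-1) ((X - ?y) / 2) t)"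
    by (rule upper_bang[OF hull(1)])
  have "?z \<noteq> zb1 X ?y"
    using l.competitor(1)[OF n_traj] len lower_bang(2,3)[OF hull(1)] n.endpoint by auto
  moreover have ne: "?z \<noteq> zb2 X ?y"
    using u.competitor(1)[OF n_traj] len upper_bang(2,3)[OF hull(1)] n.endpoint by auto
  moreover have "\<bar>?y\<bar> \<noteq> X"
  proof
    assume "\<bar>?y\<bar> = X"
    then have "?y = X \<or> ?y = - X" by linarith
    then have "zb1 X ?y = zb2 X ?y"
      by (auto simp: zb1_def zb2_def power_mult_distrib[of 2, simplified])
    then show False using hull ne by simp
  qed
  ultimately show ?thesis using A2 hull by (simp add: A2_open_hull_def)
qed

lemma Exp_bij_betw: "bij_betw Exp N A2_open_hull"
  unfolding bij_betw_def
proof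
  have N: "\<exists>\<psi>0 c X. n = ((\<psi>0, c), normal_time (sinh \<psi>0) c X) \<and> 0 < X" if "n \<in> N" for n
    using that N_iff[OF refl] by (cases n) (metis surj_pair)
  show "inj_on Exp N"
  proof (rule inj_onI)
    fix m n assume "m \<in> N" "n \<in> N" and eq: "Exp m = Exp n"
    then obtain \<psi>0 c X \<psi>0' c' X' where
      mn: "m = ((\<psi>0, c), normal_time (sinh \<psi>0) c X)" "0 < X"
          "n = ((\<psi>0', c'), normal_time (sinh \<psi>0') c' X')" "0 < X'"
      using N by metis
    then show "m = n"
      using eq normal_endpoint_inj[of X "sinh \<psi>0" c "sinh \<psi>0'" c'] by (auto simp: Exp_eq)
  qed
  show "Exp ` N = A2_open_hull"
  proof (intro equalityI subsetI)
    fix p assume "p \<in> Exp ` N"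
    then obtain \<psi>0 c X where "p = Exp ((\<psi>0, c), normal_time (sinh \<psi>0) c X)" "0 < X"
      using N by blast
    then show "p \<in> A2_open_hull" using normal_endpoint_mem by (simp add: Exp_eq)
  next
    fix p assume p: "p \<in> A2_open_hull"
    obtain X Y Z where XYZ: "p = (X, Y, Z)" by (cases p)
    with p have X: "0 < X" by (auto simp: A2_open_hull_def)
    obtain a c where ac: "normal_y a c X = Y" "normal_z a c X = Z"
      using normal_endpoint_surj p XYZ by metis
    have "Exp ((arsinh a, c), normal_time a c X) = p"
      using X ac XYZ by (subst Exp_eq) auto
    moreover have "((arsinh a, c), normal_time a c X) \<in> N"
      using X by (subst N_iff[where a = a]) auto
    ultimately show "p \<in> Exp ` N" by blast
  qed
qed

text \<open>A point of the closed region that violates a strict inequality leaves the region under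
  a small shift in the direction of \<open>z\<close> or of \<open>- x\<close>.\<close>
lemma interior_A2: "interior A2 = A2_open_hull"
proof
  have "A2_open_hull = {p. \<bar>fst (snd p)\<bar> < fst p} \<inter> {p. zb1 (fst p) (fst (snd p)) < snd (snd p)}
      \<inter> {p. snd (snd p) < zb2 (fst p) (fst (snd p))}"
    by (auto simp: A2_open_hull_def)
  moreover have "open \<dots>"
    unfolding zb1_def zb2_def by (intro open_Int open_Collect_less continuous_intros) auto
  moreover have "A2_open_hull \<subseteq> A2"
  proof
    fix p assume p: "p \<in> A2_open_hull"
    obtain X Y Z where XYZ: "p = (X, Y, Z)" by (cases p)
    with p have X: "0 < X" by (auto simp: A2_open_hull_def)
    obtain a c where "normal_y a c X = Y" "normal_z a c X = Z"
      using normal_endpoint_surj p XYZ by metis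
    then show "p \<in> A2" using normal_endpoint_mem[OF X, of a c] XYZ by simp
  qed
  ultimately show "A2_open_hull \<subseteq> interior A2" by (simp add: interior_maximal)
  show "interior A2 \<subseteq> A2_open_hull"
  proof
    fix p assume "p \<in> interior A2"
    then obtain e where e: "0 < e" "ball p e \<subseteq> A2"
      by (meson mem_interior)
    obtain x y z where p: "p = (x, y, z)" by (cases p)
    have "(x - e / 2, y, z) \<in> ball p e" "(x, y, z - e / 2) \<in> ball p e"
        "(x, y, z + e / 2) \<in> ball p e"
      using e(1) by (auto simp: p dist_Pair_Pair dist_real_def)
    then have "(x - e / 2, y, z) \<in> A2_hull" "(x, y, z - e / 2) \<in> A2_hull"
        "(x, y, z + e / 2) \<in> A2_hull"
      using e(2) A2_subset_hull by blast+
    then show "p \<in> A2_open_hull"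
      using e(1) by (auto simp: A2_hull_def A2_open_hull_def p)
  qed
qed

section \<open>Optimal synthesis\<close>

lemma plus_minus_zb1:
  assumes "\<bar>y\<bar> \<le> x"
  shows "plus_minus (x, y, zb1 x y) ((x + y) / 2) x"
proof -
  have "(x, 2 * ((x + y) / 2) - x, (2 * ((x + y) / 2)^3 - x^3) / 6) = (x, y, zb1 x y)"
    by (simp add: zb1_def power_divide field_simps)
  then show ?thesis
    using plus_minusI[of "(x + y) / 2" x] assms by simp
qed

lemma minus_plus_zb2:
  assumes "\<bar>y\<bar> \<le> x"
  shows "minus_plus (x, y, zb2 x y) ((x - y) / 2) x"
proof -
  have "(x, x - 2 * ((x - y) / 2), (x^3 - 2 * ((x - y) / 2)^3) / 6) = (x, y, zb2 x y)"
    by (simp add: zb2_def power_divide field_simps)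
  then show ?thesis
    using minus_plusI[of "(x - y) / 2" x] assms by simp
qed

(* The second and third conjuncts on boundary points have the hypotheses and switching
   times as printed.  Since x1 >= |y1| on A2, they concern at most the ray x1 = y1.  The
   last two conjuncts are the intended claims; together they cover all of the boundary
   of A2 except the initial point. *)

theorem theorem13:
  "bij_betw Exp N (interior A2) \<and>
   (\<forall>q1\<in>interior A2. \<forall>lam t1. (lam, t1) = Exp_inv q1 \<longrightarrow>
      unique_optimal q1 t1 (\<lambda>t. Exp (lam, t))) \<and>
   (\<forall>x1 y1 z1. (x1, y1, z1) \<in> frontier A2 \<and> - y1 < x1 \<and> x1 \<le> y1 \<and> z1 = zb2 x1 y1 \<longrightarrow>
      plus_minus (x1, y1, z1) ((y1 + x1) / 2) x1) \<and>
   (\<forall>x1 y1 z1. (x1, y1, z1) \<in> frontier A2 \<and> - y1 \<le> x1 \<and> x1 < y1 \<and> z1 = zb1 x1 y1 \<longrightarrow>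
      minus_plus (x1, y1, z1) ((y1 + x1) / 2) x1) \<and>
   (\<forall>x1 y1 z1. (x1, y1, z1) \<in> frontier A2 \<and> - x1 < y1 \<and> y1 \<le> x1 \<and> z1 = zb1 x1 y1 \<longrightarrow>
      plus_minus (x1, y1, z1) ((x1 + y1) / 2) x1) \<and>
   (\<forall>x1 y1 z1. (x1, y1, z1) \<in> frontier A2 \<and> - x1 \<le> y1 \<and> y1 < x1 \<and> z1 = zb2 x1 y1 \<longrightarrow>
      minus_plus (x1, y1, z1) ((x1 - y1) / 2) x1)"
proof (intro conjI allI impI ballI)
  show bij: "bij_betw Exp N (interior A2)"
    unfolding interior_A2 by (rule Exp_bij_betw)
  fix q1 lam t1 assume q1: "q1 \<in> interior A2" and inv: "(lam, t1) = Exp_inv q1"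
  have "(lam, t1) \<in> N" "Exp (lam, t1) = q1"
    using bij q1 unfolding inv Exp_inv_def bij_betw_def
    by (auto simp: the_inv_into_into f_the_inv_into_f)
  moreover obtain \<psi>0 c where lam: "lam = (\<psi>0, c)" by (cases lam)
  ultimately obtain X where X: "0 < X" and t1: "t1 = normal_time (sinh \<psi>0) c X"
    using N_iff[OF refl] by blast
  interpret normal_extremal \<psi>0 "sinh \<psi>0" c X
    by unfold_locales (use X in auto)
  show "unique_optimal q1 t1 (\<lambda>t. Exp (lam, t))"
    using unique_optimal endpoint \<open>Exp (lam, t1) = q1\<close> unfolding t1 lam by simp
next
  fix x1 y1 z1
  assume *: "(x1, y1, z1) \<in> frontier A2 \<and> - y1 < x1 \<and> x1 \<le> y1 \<and> z1 = zb2 x1 y1"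
  then have "\<bar>y1\<bar> \<le> x1" using frontier_A2_subset_hull by (auto simp: A2_hull_def)
  with * have eq: "y1 = x1" by auto
  have "(x1 + x1)^3 = 8 * x1^3" by (simp add: power3_eq_cube algebra_simps)
  then have "zb2 x1 x1 = zb1 x1 x1" by (simp add: zb1_def zb2_def)
  then show "plus_minus (x1, y1, z1) ((y1 + x1) / 2) x1"
    using plus_minus_zb1[OF \<open>\<bar>y1\<bar> \<le> x1\<close>] * eq by simp
next
  fix x1 y1 z1
  assume *: "(x1, y1, z1) \<in> frontier A2 \<and> - y1 \<le> x1 \<and> x1 < y1 \<and> z1 = zb1 x1 y1"
  then have "\<bar>y1\<bar> \<le> x1" using frontier_A2_subset_hull by (auto simp: A2_hull_def)
  then show "minus_plus (x1, y1, z1) ((y1 + x1) / 2) x1" using * by auto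
next
  fix x1 y1 z1
  assume "(x1, y1, z1) \<in> frontier A2 \<and> - x1 < y1 \<and> y1 \<le> x1 \<and> z1 = zb1 x1 y1"
  then show "plus_minus (x1, y1, z1) ((x1 + y1) / 2) x1"
    using plus_minus_zb1[of y1 x1] by auto
next
  fix x1 y1 z1
  assume "(x1, y1, z1) \<in> frontier A2 \<and> - x1 \<le> y1 \<and> y1 < x1 \<and> z1 = zb2 x1 y1"
  then show "minus_plus (x1, y1, z1) ((x1 - y1) / 2) x1"
    using minus_plus_zb2[of y1 x1] by auto
qed

end
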